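(* Let $X$ be a connected, locally compact Hausdorff space and let $n\geq 1$. There is a homeomorphism $$\Sigma\,\mathrm{Sym}^{*n}(X)\;\cong\;\overline{\mathrm{SP}}^{\,n}(\Sigma X),$$ where $\Sigma$ denotes unreduced suspension, $\mathrm{Sym}^{*n}$ the $n$-fold symmetric join and $\overline{\mathrm{SP}}^{\,n}$ the $n$-th reduced symmetric product.
   Context: Cone: $CX=[0,1]\times X/(0,x)\sim(0,x')$. Unreduced suspension: $\Sigma X=S^0*X$, equivalently $CX/X$, where $X\subset CX$ is the base $\{1\}\times X$; it is based at the class of the collapsed base. Iterated join: $X^{*n}=(X^n\times\Delta_{n-1})/\sim$ with $\Delta_{n-1}=\{(t_1,\ldots,t_n):t_i\in[0,1],\sum t_i=1\}$ and $(x_1,\ldots,x_n;t_1,\ldots,t_n)\sim(x_1',\ldots,x_n';t_1,\ldots,t_n)$ whenever $x_j=x_j'$ for all $j$ with $t_j\neq0$. Symmetric join: $\mathrm{Sym}^{*n}(X)=X^{*n}/\mathfrak S_n$, with $\mathfrak S_n$ simultaneously permuting the $x_i$ and $t_i$. Symmetric products: for a based space $Y$, $\mathrm{SP}^nY=Y^n/\mathfrak S_n$, with $\mathrm{SP}^0Y$ a point; $\mathrm{SP}^{n-1}Y\hookrightarrow\mathrm{SP}^nY$ by adjoining the basepoint; $\overline{\mathrm{SP}}^{\,n}Y=\mathrm{SP}^nY/\mathrm{SP}^{n-1}Y=Y^{(n)}/\mathfrak S_n$, where $Y^{(n)}$ is the $n$-fold smash power.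
   Formalization: The power (ΣX)^n inside the symmetric product carries the compactly generated topology instead of the plain product topology; with the plain one the claim fails for some non-σ-compact X with n = 2. The two agree whenever (ΣX)^n is a k-space, e.g. for X compact. *)

theory Defs
  imports "HOL-Analysis.Analysis" "HOL-Homology.Simplices"
begin

section \<open>Quotient spaces\<close>

text \<open>
  The points of the quotient are the equivalence classes (elements of \<open>topspace X // r\<close>), and
  \<open>\<lambda>x. r `` {x}\<close> is the projection; \<open>r\<close> is meant to be an equivalence relation on \<open>topspace X\<close>.
\<close>

definition quotient_topology :: "'a topology \<Rightarrow> ('a \<times> 'a) set \<Rightarrow> 'a set topology" where
  "quotient_topology X r =
     topology (\<lambda>U. U \<subseteq> topspace X // r \<and> openin X {x \<in> topspace X. r `` {x} \<in> U})"

lemma openin_quotient_topology: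
  "openin (quotient_topology X r) U \<longleftrightarrow>
     U \<subseteq> topspace X // r \<and> openin X {x \<in> topspace X. r `` {x} \<in> U}"
proof -
  have "istopology (\<lambda>U. U \<subseteq> topspace X // r \<and> openin X {x \<in> topspace X. r `` {x} \<in> U})"
    unfolding istopology_def
  proof (intro conjI allI impI)
    fix S T
    assume S: "S \<subseteq> topspace X // r \<and> openin X {x \<in> topspace X. r `` {x} \<in> S}"
      and T: "T \<subseteq> topspace X // r \<and> openin X {x \<in> topspace X. r `` {x} \<in> T}"
    have "{x \<in> topspace X. r `` {x} \<in> S \<inter> T} =
      {x \<in> topspace X. r `` {x} \<in> S} \<inter> {x \<in> topspace X. r `` {x} \<in> T}" by auto
    with S T show "openin X {x \<in> topspace X. r `` {x} \<in> S \<inter> T}"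
      by (simp add: openin_Int)
    show "S \<inter> T \<subseteq> topspace X // r" using S by auto
  next
    fix K
    assume K: "\<forall>S\<in>K. S \<subseteq> topspace X // r \<and> openin X {x \<in> topspace X. r `` {x} \<in> S}"
    have "{x \<in> topspace X. r `` {x} \<in> \<Union>K} = \<Union>((\<lambda>S. {x \<in> topspace X. r `` {x} \<in> S}) ` K)"
      by auto
    moreover have "openin X (\<Union>((\<lambda>S. {x \<in> topspace X. r `` {x} \<in> S}) ` K))"
      using K by (intro openin_Union) blast
    ultimately show "openin X {x \<in> topspace X. r `` {x} \<in> \<Union>K}"
      by simp
    show "\<Union>K \<subseteq> topspace X // r" using K by auto
  qed
  then show ?thesis
    by (simp add: quotient_topology_def topology_inverse')
qed

lemma topspace_quotient_topology [simp]:
  "topspace (quotient_topology X r) = topspace X // r"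
proof -
  have "{x \<in> topspace X. r `` {x} \<in> topspace X // r} = topspace X"
    by (auto simp: quotient_def)
  then have "topspace X // r \<subseteq> topspace (quotient_topology X r)"
    by (intro openin_subset) (simp add: openin_quotient_topology)
  moreover have "topspace (quotient_topology X r) \<subseteq> topspace X // r"
    using openin_topspace [of "quotient_topology X r"] by (simp only: openin_quotient_topology)
  ultimately show ?thesis
    by (rule subset_antisym [rotated])
qed

lemma quotient_map_quotient_topology:
  "quotient_map X (quotient_topology X r) (\<lambda>x. r `` {x})"
  unfolding quotient_map_def topspace_quotient_topology
proof (intro conjI allI impI)
  show "(\<lambda>x. r `` {x}) ` topspace X = topspace X // r"
    by (auto simp: quotient_def)
qed (simp add: openin_quotient_topology)

definition collapse_topology :: "'a topology \<Rightarrow> 'a set \<Rightarrow> 'a set topology" where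
  "collapse_topology X A =
     quotient_topology X
       {(x, y). x \<in> topspace X \<and> y \<in> topspace X \<and> (x = y \<or> x \<in> A \<and> y \<in> A)}"


section \<open>Compactly generated topology\<close>

text \<open>
  A set is open in the k-ification iff its trace on every compact subspace is relatively open.
\<close>

definition kification :: "'a topology \<Rightarrow> 'a topology" where
  "kification X =
     topology (\<lambda>U. U \<subseteq> topspace X \<and>
       (\<forall>K. compactin X K \<longrightarrow> openin (subtopology X K) (K \<inter> U)))"

lemma openin_kification:
  "openin (kification X) U \<longleftrightarrow>
     U \<subseteq> topspace X \<and> (\<forall>K. compactin X K \<longrightarrow> openin (subtopology X K) (K \<inter> U))"
proof -
  have "istopology (\<lambda>U. U \<subseteq> topspace X \<and>
       (\<forall>K. compactin X K \<longrightarrow> openin (subtopology X K) (K \<inter> U)))"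
    unfolding istopology_def
  proof (intro conjI allI impI)
    fix S T K
    assume S: "S \<subseteq> topspace X \<and> (\<forall>K. compactin X K \<longrightarrow> openin (subtopology X K) (K \<inter> S))"
      and T: "T \<subseteq> topspace X \<and> (\<forall>K. compactin X K \<longrightarrow> openin (subtopology X K) (K \<inter> T))"
    show "S \<inter> T \<subseteq> topspace X" using S by auto
    assume "compactin X K"
    then have "openin (subtopology X K) (K \<inter> S)" "openin (subtopology X K) (K \<inter> T)"
      using S T by simp_all
    then have "openin (subtopology X K) ((K \<inter> S) \<inter> (K \<inter> T))"
      by (rule openin_Int)
    then show "openin (subtopology X K) (K \<inter> (S \<inter> T))"
      by (simp add: Int_ac)
  next
    fix \<K> K
    assume K: "\<forall>S\<in>\<K>. S \<subseteq> topspace X \<and>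
       (\<forall>K. compactin X K \<longrightarrow> openin (subtopology X K) (K \<inter> S))"
    show "\<Union>\<K> \<subseteq> topspace X" using K by auto
    assume "compactin X K"
    then have "openin (subtopology X K) (\<Union>((\<lambda>S. K \<inter> S) ` \<K>))"
      using K by (intro openin_Union) blast
    then show "openin (subtopology X K) (K \<inter> \<Union>\<K>)"
      by (simp only: Int_Union)
  qed
  then show ?thesis
    by (simp only: kification_def topology_inverse')
qed

lemma topspace_kification [simp]: "topspace (kification X) = topspace X"
proof (rule subset_antisym)
  show "topspace (kification X) \<subseteq> topspace X"
    using openin_topspace [of "kification X"] by (simp only: openin_kification)
  have "openin (subtopology X K) (K \<inter> topspace X)" for K
    by (rule openin_subtopology_Int2) simp
  then show "topspace X \<subseteq> topspace (kification X)"
    by (intro openin_subset) (simp add: openin_kification)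
qed

lemma kification_eq: "k_space X \<Longrightarrow> kification X = X"
proof (rule iffD2 [OF topology_eq], rule allI)
  fix U
  assume "k_space X"
  then show "openin (kification X) U \<longleftrightarrow> openin X U"
    unfolding openin_kification k_space_open
    using openin_subset [of X U] openin_subtopology_Int2 [of X U] by blast
qed


section \<open>Cone and unreduced suspension\<close>

definition topological_cone :: "'a topology \<Rightarrow> (real \<times> 'a) set topology" where
  "topological_cone X =
     collapse_topology (prod_topology (top_of_set {0..1}) X) ({0} \<times> topspace X)"

text \<open>The base consists of the points \<open>(1,x)\<close>, whose classes in the cone are singletons.\<close>

definition cone_base :: "'a topology \<Rightarrow> (real \<times> 'a) set set" where
  "cone_base X = (\<lambda>x. {(1, x)}) ` topspace X"

definition suspension :: "'a topology \<Rightarrow> (real \<times> 'a) set set topology" where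
  "suspension X = collapse_topology (topological_cone X) (cone_base X)"

text \<open>The class of the collapsed base, as a point of the suspension, is the set of its members.\<close>

definition suspension_point :: "'a topology \<Rightarrow> (real \<times> 'a) set set" where
  "suspension_point X = cone_base X"

lemma suspension_point_in_suspension:
  assumes "topspace X \<noteq> {}"
  shows "suspension_point X \<in> topspace (suspension X)"
proof -
  have base: "cone_base X \<subseteq> topspace (topological_cone X)"
  proof
    fix c assume "c \<in> cone_base X"
    then obtain x where x: "x \<in> topspace X" "c = {(1, x)}"
      by (auto simp: cone_base_def)
    let ?T = "topspace (prod_topology (top_of_set {0..1::real}) X)"
    let ?r = "{(p, q). p \<in> ?T \<and> q \<in> ?T \<and>
      (p = q \<or> p \<in> {0} \<times> topspace X \<and> q \<in> {0} \<times> topspace X)}"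
    have "(1, x) \<in> ?T" using x by simp
    then have "?r `` {(1, x)} \<in> ?T // ?r" by (rule quotientI)
    moreover have "?r `` {(1, x)} = {(1, x)}"
      using \<open>(1, x) \<in> ?T\<close> by auto
    ultimately show "c \<in> topspace (topological_cone X)"
      by (simp only: topological_cone_def collapse_topology_def topspace_quotient_topology x)
  qed
  have "cone_base X \<noteq> {}" using assms by (simp only: cone_base_def image_is_empty) simp
  then obtain b where b: "b \<in> cone_base X" by blast
  let ?T = "topspace (topological_cone X)"
  let ?r = "{(p, q). p \<in> ?T \<and> q \<in> ?T \<and> (p = q \<or> p \<in> cone_base X \<and> q \<in> cone_base X)}"
  have "?r `` {b} \<in> ?T // ?r" using b base by (intro quotientI) blast
  moreover have "?r `` {b} = cone_base X" using b base by blast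
  ultimately show ?thesis
    by (simp only: suspension_def collapse_topology_def topspace_quotient_topology
        suspension_point_def)
qed


section \<open>Iterated join and symmetric join\<close>

text \<open>
  Indices run over \<open>{..<n}\<close>; \<open>standard_simplex (n - 1)\<close> consists of functions on \<open>nat\<close> vanishing
  outside \<open>{..<n}\<close>, so it is \<open>\<Delta>\<^sub>n\<^sub>-\<^sub>1\<close> (for \<open>n \<ge> 1\<close>). A permutation of \<open>{..<n}\<close> acts by
  precomposition on both coordinates.
\<close>

definition pre_join :: "nat \<Rightarrow> 'a topology \<Rightarrow> ((nat \<Rightarrow> 'a) \<times> (nat \<Rightarrow> real)) topology" where
  "pre_join n X =
     prod_topology (product_topology (\<lambda>_. X) {..<n})
       (subtopology (powertop_real UNIV) (standard_simplex (n - 1)))"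

definition iterated_join ::
    "nat \<Rightarrow> 'a topology \<Rightarrow> ((nat \<Rightarrow> 'a) \<times> (nat \<Rightarrow> real)) set topology" where
  "iterated_join n X =
     quotient_topology (pre_join n X)
       {((x, t), (x', t')). (x, t) \<in> topspace (pre_join n X) \<and> (x', t') \<in> topspace (pre_join n X) \<and>
          t = t' \<and> (\<forall>j<n. t j \<noteq> 0 \<longrightarrow> x j = x' j)}"

definition symmetric_join ::
    "nat \<Rightarrow> 'a topology \<Rightarrow> ((nat \<Rightarrow> 'a) \<times> (nat \<Rightarrow> real)) set set topology" where
  "symmetric_join n X =
     quotient_topology (iterated_join n X)
       {(c, d). c \<in> topspace (iterated_join n X) \<and> d \<in> topspace (iterated_join n X) \<and>
          (\<exists>\<sigma>. \<sigma> permutes {..<n} \<and> d = (\<lambda>(x, t). (x \<circ> \<sigma>, t \<circ> \<sigma>)) ` c)}"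


section \<open>Symmetric products\<close>

text \<open>
  The power \<open>Y\<^sup>n\<close> carries the compactly generated topology. By \<open>kification_eq\<close> this is the product
  topology whenever the latter is a k-space, for instance if \<open>Y\<close> is compact or locally compact
  Hausdorff. In general the convention matters: the suspension of a non-compact space is not
  locally compact, its powers need not be k-spaces, and with the plain product topology the
  symmetric product need not be a quotient of \<open>(X \<times> [0,1])\<^sup>n\<close>. In the joins the convention makes no
  difference for locally compact Hausdorff \<open>X\<close>, as \<open>X\<^sup>n \<times> \<Delta>\<^sub>n\<^sub>-\<^sub>1\<close> is again locally compact
  Hausdorff.
\<close>

definition power_topology :: "nat \<Rightarrow> 'b topology \<Rightarrow> (nat \<Rightarrow> 'b) topology" where
  "power_topology n Y = kification (product_topology (\<lambda>_. Y) {..<n})"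

definition perm_rel :: "nat \<Rightarrow> 'b topology \<Rightarrow> ((nat \<Rightarrow> 'b) \<times> (nat \<Rightarrow> 'b)) set" where
  "perm_rel n Y =
     {(f, g). f \<in> topspace (power_topology n Y) \<and> g \<in> topspace (power_topology n Y) \<and>
        (\<exists>\<sigma>. \<sigma> permutes {..<n} \<and> g = f \<circ> \<sigma>)}"

definition symmetric_product :: "nat \<Rightarrow> 'b topology \<Rightarrow> (nat \<Rightarrow> 'b) set topology" where
  "symmetric_product n Y = quotient_topology (power_topology n Y) (perm_rel n Y)"

text \<open>
  \<open>adjoin_basepoint n Y y\<close> is the inclusion of the \<open>n\<close>-th into the \<open>Suc n\<close>-th symmetric product of
  the based space \<open>(Y, y)\<close>; the union below is over representatives, all of which yield the same
  class.
\<close>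

definition adjoin_basepoint ::
    "nat \<Rightarrow> 'b topology \<Rightarrow> 'b \<Rightarrow> (nat \<Rightarrow> 'b) set \<Rightarrow> (nat \<Rightarrow> 'b) set" where
  "adjoin_basepoint n Y y c = (\<Union>f\<in>c. perm_rel (Suc n) Y `` {f(n := y)})"

text \<open>Only meaningful for \<open>n \<ge> 1\<close>.\<close>

definition reduced_symmetric_product ::
    "nat \<Rightarrow> 'b topology \<Rightarrow> 'b \<Rightarrow> (nat \<Rightarrow> 'b) set set topology" where
  "reduced_symmetric_product n Y y =
     collapse_topology (symmetric_product n Y)
       (adjoin_basepoint (n - 1) Y y ` topspace (symmetric_product (n - 1) Y))"

end

theory Submission
  imports Defs
begin

text \<open>
  Both sides are quotients of \<open>X\<^sup>n \<times> ([0,1] \<times> \<Delta>\<^sub>n\<^sub>-\<^sub>1)\<close>, with the same fibres. A point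
  \<open>(x, (s, t))\<close> goes on the left to the class of \<open>(s, (x, t))\<close>, and on the right to the class of the
  tuple \<open>(u\<^sub>i, x\<^sub>i)\<close> in the power of \<open>[0,1] \<times> X\<close>, where \<open>u = s t / max t\<close> is the point of the cube on
  the ray through \<open>t\<close> with sup norm \<open>s\<close>. Thus \<open>s = 0\<close> corresponds to \<open>u = 0\<close>, the tuple all of whose
  entries are the cone point, and \<open>s = 1\<close> to some \<open>u\<^sub>i = 1\<close>, a tuple with an entry at the base point.
  The map \<open>(s, t) \<mapsto> u\<close> is a quotient map by compactness, and stays one after taking the product
  with the locally compact Hausdorff space \<open>X\<^sup>n\<close>. The remaining point is that the power of the
  quotient map \<open>[0,1] \<times> X \<rightarrow> \<Sigma>X\<close> is a quotient map onto the compactly generated power.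
\<close>

text \<open>Each map is constant on the fibres of the other and so factors through it. The two
  induced continuous maps are mutually inverse because they are so on the images of points of
  \<open>P\<close>.\<close>

lemma homeomorphic_space_if_quotient_maps_same_fibres:
  assumes f: "quotient_map P L f" and g: "quotient_map P R g"
    and eq: "\<And>x y. \<lbrakk>x \<in> topspace P; y \<in> topspace P\<rbrakk> \<Longrightarrow> f x = f y \<longleftrightarrow> g x = g y"
  shows "L homeomorphic_space R"
proof -
  obtain h where h: "continuous_map L R h" "\<And>x. x \<in> topspace P \<Longrightarrow> h (f x) = g x"
    using quotient_map_lift_exists [OF f quotient_imp_continuous_map [OF g]] eq by metis
  obtain k where k: "continuous_map R L k" "\<And>x. x \<in> topspace P \<Longrightarrow> k (g x) = f x"
    using quotient_map_lift_exists [OF g quotient_imp_continuous_map [OF f]] eq by metis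
  have "homeomorphic_maps L R h k"
    unfolding homeomorphic_maps_def
    using h k quotient_imp_surjective_map [OF f] quotient_imp_surjective_map [OF g]
    by (metis (no_types, lifting) imageE)
  then show ?thesis
    by (auto simp: homeomorphic_space_def)
qed

section \<open>Powers of quotient maps\<close>

text \<open>
  Factors \<open>Z\<close> are replaced one at a time by compact subsets of \<open>Y\<close>; at each step the product of the other
  factors is locally compact Hausdorff, so that its product with \<open>q\<close> is again a quotient map.
\<close>

lemma openin_prod_power_compact_factors:
  fixes Z :: "'a topology" and Y :: "'b topology" and n j :: nat
  assumes q: "quotient_map Z Y q"
    and Z: "locally_compact_space Z" "Hausdorff_space Z" and Y: "Hausdorff_space Y"
    and B: "\<And>i. i < n \<Longrightarrow> compactin Y (B i)"
    and U: "openin (product_topology (\<lambda>_. Z) {..<n})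
              {f \<in> topspace (product_topology (\<lambda>_. Z) {..<n}). (\<lambda>i\<in>{..<n}. q (f i)) \<in> U}"
    and "j \<le> n"
  defines "P \<equiv> \<lambda>j. prod_topology (product_topology (\<lambda>_. Z) {..<j})
                     (product_topology (\<lambda>i. subtopology Y (B i)) {j..<n})"
  shows "openin (P j) {p \<in> topspace (P j).
           (\<lambda>i\<in>{..<n}. if i < j then q (fst p i) else snd p i) \<in> U}"
  using \<open>j \<le> n\<close>
\<comment> \<open>The induction descends from \<open>n\<close>: each step trades the last remaining
  factor \<open>Z\<close> for the compact piece \<open>B j\<close>.\<close>
proof (induction rule: inc_induct)
  \<comment> \<open>The product over the empty range \<open>{n..<n}\<close> is a single point, so
    the claim is the assumption on \<open>U\<close> pulled back along \<open>fst\<close>.\<close>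
  case base
  have c: "continuous_map (P n) (product_topology (\<lambda>_. Z) {..<n}) fst"
    unfolding P_def by (rule continuous_map_fst)
  have eq: "{p \<in> topspace (P n). (\<lambda>i\<in>{..<n}. if i < n then q (fst p i) else snd p i) \<in> U} =
        {p \<in> topspace (P n). fst p \<in>
          {f \<in> topspace (product_topology (\<lambda>_. Z) {..<n}). (\<lambda>i\<in>{..<n}. q (f i)) \<in> U}}"
    using continuous_map_image_subset_topspace [OF c]
    by (auto simp: restrict_def cong: if_cong)
  show ?case
    unfolding eq by (rule openin_continuous_map_preimage [OF c U])
next
  case (step j)
  \<comment> \<open>\<open>W\<close> collects all factors except the \<open>j\<close>-th. In
    \<open>V\<close> the \<open>j\<close>-th coordinate ranges over all of \<open>Y\<close>, because
    this is the codomain of \<open>q\<close>; it is confined to \<open>B j\<close> only at the end,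
    by \<open>spl\<close>.\<close>
  define W where "W = prod_topology (product_topology (\<lambda>_. Z) {..<j})
                     (product_topology (\<lambda>i. subtopology Y (B i)) {Suc j..<n})"
  define V where "V = {w \<in> topspace (prod_topology W Y).
    (\<lambda>i\<in>{..<n}. if i < j then q (fst (fst w) i) else if i = j then snd w else snd (fst w) i) \<in> U}"
  have W: "locally_compact_space W" "Hausdorff_space W"
    unfolding W_def using Z Y B
    by (auto intro!: compact_imp_locally_compact_space Hausdorff_space_subtopology
        simp: locally_compact_space_prod_topology Hausdorff_space_prod_topology
        locally_compact_space_product_topology Hausdorff_space_product_topology compact_space_subtopology)
  \<comment> \<open>Inserting \<open>z\<close> at position \<open>j\<close> of the tuple in
    \<open>Z\<close> makes the preimage of \<open>V\<close> under identity times \<open>q\<close>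
    equal to the pullback of the open set in the induction hypothesis.\<close>
  have ext: "continuous_map (prod_topology W Z) (P (Suc j))
      (\<lambda>(w, z). (\<lambda>i\<in>{..<Suc j}. if i = j then z else fst w i, snd w))"
  proof -
    have "continuous_map (prod_topology W Z) (product_topology (\<lambda>_. Z) {..<Suc j})
        (\<lambda>p. \<lambda>i\<in>{..<Suc j}. if i = j then snd p else fst (fst p) i)"
      unfolding continuous_map_componentwise
    proof (intro conjI ballI)
      fix i assume i: "i \<in> {..<Suc j}"
      show "continuous_map (prod_topology W Z) Z
         (\<lambda>p. (\<lambda>i\<in>{..<Suc j}. if i = j then snd p else fst (fst p) i) i)"
      proof (cases "i = j")
        case True
        then show ?thesis by (simp add: continuous_map_snd)
      next
        case False
        have "continuous_map (prod_topology W Z) (product_topology (\<lambda>_. Z) {..<j}) (fst \<circ> fst)"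
          unfolding W_def by (rule continuous_map_compose [OF continuous_map_fst continuous_map_fst])
        then have "continuous_map (prod_topology W Z) Z ((\<lambda>x. x i) \<circ> (fst \<circ> fst))"
          using i False continuous_map_compose [OF _ continuous_map_product_projection [of i "{..<j}" "\<lambda>_. Z"]]
          by auto
        then show ?thesis using i False by (simp add: o_def)
      qed
    qed auto
    moreover have "continuous_map (prod_topology W Z)
       (product_topology (\<lambda>i. subtopology Y (B i)) {Suc j..<n}) (snd \<circ> fst)"
      unfolding W_def by (rule continuous_map_compose [OF continuous_map_fst continuous_map_snd])
    ultimately show ?thesis
      unfolding P_def by (simp add: case_prod_unfold continuous_map_paired o_def)
  qed
  \<comment> \<open>Local compactness of the other factors enters here: identity times
    \<open>q\<close> stays a quotient map, so openness of \<open>V\<close> can be tested upstairs,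
    with \<open>Z\<close> in place of \<open>Y\<close>.\<close>
  have QV: "quotient_map (prod_topology W Z) (prod_topology W Y) (\<lambda>(w, z). (w, q z))"
    using quotient_map_prod_right W q by blast
  have "openin (prod_topology W Y) V"
  proof -
    have "V \<subseteq> topspace (prod_topology W Y)" by (auto simp: V_def)
    moreover have "openin (prod_topology W Z)
       {p \<in> topspace (prod_topology W Z). (\<lambda>(w, z). (w, q z)) p \<in> V}"
    proof -
      have eq: "{p \<in> topspace (prod_topology W Z). (\<lambda>(w, z). (w, q z)) p \<in> V} =
        {p \<in> topspace (prod_topology W Z).
          (\<lambda>(w, z). (\<lambda>i\<in>{..<Suc j}. if i = j then z else fst w i, snd w)) p \<in>
           {p \<in> topspace (P (Suc j)). (\<lambda>i\<in>{..<n}. if i < Suc j then q (fst p i) else snd p i) \<in> U}}"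
        (is "?A = ?B")
      proof -
        have "p \<in> ?A \<longleftrightarrow> p \<in> ?B" if p: "p \<in> topspace (prod_topology W Z)" for p
        proof -
          obtain a b z where pq: "p = ((a, b), z)" by (metis surj_pair)
          have "(\<lambda>i\<in>{..<n}. if i < j then q (a i) else if i = j then q z else b i) =
            (\<lambda>i\<in>{..<n}. if i < Suc j
               then q ((\<lambda>i\<in>{..<Suc j}. if i = j then z else a i) i) else b i)"
            by (rule restrict_ext) auto
          moreover have "(\<lambda>(w, z). (w, q z)) p \<in> topspace (prod_topology W Y)"
            using QV p unfolding quotient_map_def by blast
          moreover have "(\<lambda>(w, z). (\<lambda>i\<in>{..<Suc j}. if i = j then z else fst w i, snd w)) p
              \<in> topspace (P (Suc j))"
            using continuous_map_image_subset_topspace [OF ext] p by blast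
          ultimately show ?thesis
            using p unfolding pq V_def mem_Collect_eq prod.case fst_conv snd_conv by simp
        qed
        then show ?thesis by blast
      qed
      show ?thesis
        unfolding eq by (rule openin_continuous_map_preimage [OF ext step.IH])
    qed
    ultimately show ?thesis
      using QV unfolding quotient_map_def by blast
  qed
  \<comment> \<open>Splits off coordinate \<open>j\<close> and includes \<open>B j\<close> into
    \<open>Y\<close>; the set to be proved open is the preimage of \<open>V\<close> under this
    map.\<close>
  moreover have spl: "continuous_map (P j) (prod_topology W Y)
      (\<lambda>p. ((fst p, restrict (snd p) {Suc j..<n}), snd p j))"
  proof -
    have "continuous_map (P j) (product_topology (\<lambda>i. subtopology Y (B i)) {Suc j..<n})
        (\<lambda>p. restrict (snd p) {Suc j..<n})"
      unfolding continuous_map_componentwise P_def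
      by (auto intro!: continuous_map_compose [OF continuous_map_snd
           continuous_map_product_projection, unfolded o_def])
    moreover have "continuous_map (P j) (subtopology Y (B j)) (\<lambda>p. snd p j)"
      unfolding P_def using step.hyps
      by (intro continuous_map_compose [OF continuous_map_snd
           continuous_map_product_projection, unfolded o_def]) auto
    moreover have "continuous_map (P j) (product_topology (\<lambda>_. Z) {..<j}) fst"
      unfolding P_def by (rule continuous_map_fst)
    ultimately show ?thesis
      unfolding W_def by (simp add: continuous_map_paired continuous_map_in_subtopology)
  qed
  moreover have eq: "{p \<in> topspace (P j). (\<lambda>i\<in>{..<n}. if i < j then q (fst p i) else snd p i) \<in> U} =
     {p \<in> topspace (P j). ((fst p, restrict (snd p) {Suc j..<n}), snd p j) \<in> V}" (is "?A = ?B")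
  proof -
    have "p \<in> ?A \<longleftrightarrow> p \<in> ?B" if p: "p \<in> topspace (P j)" for p
    proof -
      have "((fst p, restrict (snd p) {Suc j..<n}), snd p j) \<in> topspace (prod_topology W Y)"
        using continuous_map_image_subset_topspace [OF spl] p by blast
      moreover have "(\<lambda>i\<in>{..<n}. if i < j then q (fst p i) else snd p i) =
         (\<lambda>i\<in>{..<n}. if i < j then q (fst p i) else if i = j then snd p j
            else restrict (snd p) {Suc j..<n} i)"
        by (rule restrict_ext) auto
      ultimately show ?thesis
        using p unfolding V_def mem_Collect_eq fst_conv snd_conv by simp
    qed
    then show ?thesis by blast
  qed
  ultimately show ?case
    unfolding eq by (intro openin_continuous_map_preimage [OF spl])
qed

lemma topspace_power_topology [simp]:
  "topspace (power_topology n Y) = {..<n} \<rightarrow>\<^sub>E topspace Y"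
  by (simp add: power_topology_def)

text \<open>For continuity, the power of \<open>Z\<close> is a k-space, so openness is tested on
  compact sets, and these have compact images in the power of \<open>Y\<close>. Conversely, a
  compact set in the power of \<open>Y\<close> lies in a box of compact sets, to which the preceding
  lemma applies with \<open>j = 0\<close>.\<close>

theorem quotient_map_power_topology:
  fixes Z :: "'a topology" and Y :: "'b topology"
  assumes q: "quotient_map Z Y q"
    and Z: "locally_compact_space Z" "Hausdorff_space Z" and Y: "Hausdorff_space Y"
  shows "quotient_map (product_topology (\<lambda>_. Z) {..<n}) (power_topology n Y)
           (\<lambda>f. \<lambda>i\<in>{..<n}. q (f i))"
    (is "quotient_map ?Z _ ?q")
proof -
  have "continuous_map ?Z Y (\<lambda>f. q (f i))" if "i < n" for i
    using continuous_map_compose [OF _ quotient_imp_continuous_map [OF q],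
        of ?Z "\<lambda>f. f i"] continuous_map_product_projection [of i "{..<n}" "\<lambda>_. Z"] that
    by (simp add: o_def)
  then have cont: "continuous_map ?Z (product_topology (\<lambda>_. Y) {..<n}) ?q"
    unfolding continuous_map_componentwise by auto
  have surj: "?q ` topspace ?Z = topspace (power_topology n Y)"
  proof
    show "?q ` topspace ?Z \<subseteq> topspace (power_topology n Y)"
      using continuous_map_image_subset_topspace [OF cont] by simp
    show "topspace (power_topology n Y) \<subseteq> ?q ` topspace ?Z"
    proof
      fix g assume g: "g \<in> topspace (power_topology n Y)"
      then have "\<forall>i\<in>{..<n}. \<exists>z\<in>topspace Z. q z = g i"
        using quotient_imp_surjective_map [OF q] by (force simp: PiE_iff)
      then obtain f where f: "\<And>i. i < n \<Longrightarrow> f i \<in> topspace Z \<and> q (f i) = g i"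
        by (metis lessThan_iff)
      then have "restrict f {..<n} \<in> topspace ?Z" by auto
      moreover have "?q (restrict f {..<n}) = g"
        using f g by (intro PiE_ext [where k = "{..<n}" and s = "\<lambda>_. topspace Y"]) auto
      ultimately show "g \<in> ?q ` topspace ?Z" by (metis imageI)
    qed
  qed
  have "openin ?Z {f \<in> topspace ?Z. ?q f \<in> U} \<longleftrightarrow> openin (power_topology n Y) U"
    if U: "U \<subseteq> topspace (power_topology n Y)" for U
  proof
    assume op: "openin (power_topology n Y) U"
    \<comment> \<open>This reduces openness of the preimage to its traces on compact sets, the only
      information that an open set of the k-ification provides.\<close>
    have "k_space ?Z"
      using Z by (intro locally_compact_imp_k_space) (auto simp: locally_compact_space_product_topology)
    have trace: "openin (subtopology ?Z K) (K \<inter> {f \<in> topspace ?Z. ?q f \<in> U})"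
      if K: "compactin ?Z K" for K
    proof -
      have "compactin (product_topology (\<lambda>_. Y) {..<n}) (?q ` K)"
        using image_compactin [OF K cont] .
      then have "openin (subtopology (product_topology (\<lambda>_. Y) {..<n}) (?q ` K)) (?q ` K \<inter> U)"
        using op by (simp add: power_topology_def openin_kification)
      moreover have "continuous_map (subtopology ?Z K)
          (subtopology (product_topology (\<lambda>_. Y) {..<n}) (?q ` K)) ?q"
        using cont by (auto simp: continuous_map_in_subtopology continuous_map_from_subtopology)
      ultimately have "openin (subtopology ?Z K)
          {f \<in> topspace (subtopology ?Z K). ?q f \<in> ?q ` K \<inter> U}"
        by (rule openin_continuous_map_preimage [rotated])
      moreover have "{f \<in> topspace (subtopology ?Z K). ?q f \<in> ?q ` K \<inter> U} =
          K \<inter> {f \<in> topspace ?Z. ?q f \<in> U}"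
        by auto
      ultimately show ?thesis by simp
    qed
    show "openin ?Z {f \<in> topspace ?Z. ?q f \<in> U}"
      using \<open>k_space ?Z\<close> [unfolded k_space_open, rule_format, OF conjI [OF _ allI [OF impI [OF trace]]]]
      by blast
  next
    assume op: "openin ?Z {f \<in> topspace ?Z. ?q f \<in> U}"
    have "openin (subtopology (product_topology (\<lambda>_. Y) {..<n}) K) (K \<inter> U)"
      if K: "compactin (product_topology (\<lambda>_. Y) {..<n}) K" for K
    proof -
      \<comment> \<open>The projections of \<open>K\<close> are the sides of a compact box
        containing \<open>K\<close>.\<close>
      define B where "B = (\<lambda>i. (\<lambda>f. f i) ` K)"
      have B: "compactin Y (B i)" if "i < n" for i
        unfolding B_def using that
        by (intro image_compactin [OF K continuous_map_product_projection]) auto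
      have KB: "K \<subseteq> (\<Pi>\<^sub>E i\<in>{..<n}. B i)"
        using compactin_subset_topspace [OF K] by (auto simp: B_def PiE_iff)
      let ?S = "product_topology (\<lambda>i. subtopology Y (B i)) {..<n}"
      let ?P = "prod_topology (product_topology (\<lambda>_. Z) {..<0::nat})
                     (product_topology (\<lambda>i. subtopology Y (B i)) {0..<n})"
      have "openin ?P {p \<in> topspace ?P.
           (\<lambda>i\<in>{..<n}. if i < 0 then q (fst p i) else snd p i) \<in> U}"
        using openin_prod_power_compact_factors [OF q Z Y B op, where j = 0] by simp
      \<comment> \<open>At \<open>j = 0\<close> the first factor is a power with empty index set,
        whose only point is the everywhere undefined function.\<close>
      moreover have c: "continuous_map ?S ?P (\<lambda>g. (\<lambda>_. undefined, g))"
        by (simp add: continuous_map_paired atLeast0LessThan)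
      ultimately have "openin ?S {g \<in> topspace ?S. (\<lambda>_. undefined, g) \<in> {p \<in> topspace ?P.
           (\<lambda>i\<in>{..<n}. if i < 0 then q (fst p i) else snd p i) \<in> U}}"
        by (rule openin_continuous_map_preimage [rotated])
      moreover have "{g \<in> topspace ?S. (\<lambda>_. undefined, g) \<in> {p \<in> topspace ?P.
           (\<lambda>i\<in>{..<n}. if i < 0 then q (fst p i) else snd p i) \<in> U}} = topspace ?S \<inter> U"
        (is "?A = _")
      proof -
        have "g \<in> ?A \<longleftrightarrow> g \<in> U" if g: "g \<in> topspace ?S" for g
        proof -
          have "restrict g {..<n} = g"
            using g by (simp add: PiE_restrict)
          moreover have "(\<lambda>_. undefined, g) \<in> topspace ?P"
            using g by (simp add: atLeast0LessThan)
          ultimately show ?thesis using g by simp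
        qed
        then show ?thesis by blast
      qed
      moreover have "?S = subtopology (product_topology (\<lambda>_. Y) {..<n}) (\<Pi>\<^sub>E i\<in>{..<n}. B i)"
        by (rule subtopology_product_topology [symmetric])
      ultimately have "openin (subtopology (product_topology (\<lambda>_. Y) {..<n}) (\<Pi>\<^sub>E i\<in>{..<n}. B i))
          (topspace ?S \<inter> U)"
        by simp
      \<comment> \<open>Relative openness passes from the box to its subset \<open>K\<close>: the
        same open \<open>T\<close> cuts out the trace of \<open>U\<close> on
        \<open>K\<close>.\<close>
      then obtain T where T: "openin (product_topology (\<lambda>_. Y) {..<n}) T"
          "topspace ?S \<inter> U = T \<inter> (\<Pi>\<^sub>E i\<in>{..<n}. B i)"
        by (auto simp: openin_subtopology)
      have "K \<subseteq> topspace ?S"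
        using KB compactin_subset_topspace [OF K] by (fastforce simp: PiE_iff)
      then have "K \<inter> U = T \<inter> K" using T(2) KB by blast
      then show ?thesis
        using T(1) by (auto simp: openin_subtopology)
    qed
    then show "openin (power_topology n Y) U"
      using U by (simp add: power_topology_def openin_kification)
  qed
  with surj show ?thesis
    by (simp add: quotient_map_def)
qed

section \<open>Projections onto suspensions and joins\<close>

abbreviation collapse_rel :: "'a topology \<Rightarrow> 'a set \<Rightarrow> ('a \<times> 'a) set" where
  "collapse_rel X A \<equiv> {(x, y). x \<in> topspace X \<and> y \<in> topspace X \<and> (x = y \<or> x \<in> A \<and> y \<in> A)}"

lemma collapse_class_eq_iff:
  assumes "x \<in> topspace X" "y \<in> topspace X"
  shows "collapse_rel X A `` {x} = collapse_rel X A `` {y} \<longleftrightarrow> x = y \<or> x \<in> A \<and> y \<in> A"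
  using assms by blast

lemma quotient_map_collapse:
  "quotient_map X (collapse_topology X A) (\<lambda>x. collapse_rel X A `` {x})"
  unfolding collapse_topology_def by (rule quotient_map_quotient_topology)

definition cone_map :: "'a topology \<Rightarrow> real \<times> 'a \<Rightarrow> (real \<times> 'a) set" where
  "cone_map X p =
     collapse_rel (prod_topology (top_of_set {0..1}) X) ({0} \<times> topspace X) `` {p}"

definition suspension_map :: "'a topology \<Rightarrow> real \<times> 'a \<Rightarrow> (real \<times> 'a) set set" where
  "suspension_map X p = collapse_rel (topological_cone X) (cone_base X) `` {cone_map X p}"

lemma quotient_map_cone:
  "quotient_map (prod_topology (top_of_set {0..1}) X) (topological_cone X) (cone_map X)"
  unfolding topological_cone_def cone_map_def by (rule quotient_map_collapse)

lemma quotient_map_suspension: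
  "quotient_map (prod_topology (top_of_set {0..1}) X) (suspension X) (suspension_map X)"
  using quotient_map_compose [OF quotient_map_cone quotient_map_collapse]
  unfolding suspension_def suspension_map_def o_def by blast

lemma cone_map_eq_iff:
  assumes "s \<in> {0..1}" "x \<in> topspace X" "s' \<in> {0..1}" "x' \<in> topspace X"
  shows "cone_map X (s, x) = cone_map X (s', x') \<longleftrightarrow> s = s' \<and> x = x' \<or> s = 0 \<and> s' = 0"
  unfolding cone_map_def using assms by (subst collapse_class_eq_iff) auto

lemma cone_base_eq_image: "cone_base X = (\<lambda>x. cone_map X (1, x)) ` topspace X"
  unfolding cone_base_def by (rule image_cong) (auto simp: cone_map_def)

lemma cone_map_in_cone_base_iff:
  assumes "s \<in> {0..1}" "x \<in> topspace X"
  shows "cone_map X (s, x) \<in> cone_base X \<longleftrightarrow> s = 1"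
  using assms by (auto simp: cone_base_eq_image cone_map_eq_iff)

lemma cone_map_in_topspace:
  assumes "s \<in> {0..1}" "x \<in> topspace X"
  shows "cone_map X (s, x) \<in> topspace (topological_cone X)"
  using quotient_imp_surjective_map [OF quotient_map_cone [of X]] assms by auto

text \<open>The end at 0 is collapsed in the cone and the end at 1 afterwards, to two different
  points; hence the height survives in every case.\<close>

lemma suspension_map_eq_iff:
  assumes "s \<in> {0..1}" "x \<in> topspace X" "s' \<in> {0..1}" "x' \<in> topspace X"
  shows "suspension_map X (s, x) = suspension_map X (s', x') \<longleftrightarrow>
           s = s' \<and> (x = x' \<or> s = 0 \<or> s = 1)"
  unfolding suspension_map_def using assms
  by (subst collapse_class_eq_iff)
    (auto simp: cone_map_in_topspace cone_map_in_cone_base_iff cone_map_eq_iff)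

lemma suspension_map_eq_point_iff:
  assumes "s \<in> {0..1}" "x \<in> topspace X"
  shows "suspension_map X (s, x) = suspension_point X \<longleftrightarrow> s = 1"
proof
  assume "suspension_map X (s, x) = suspension_point X"
  moreover have "cone_map X (s, x) \<in> suspension_map X (s, x)"
    unfolding suspension_map_def using cone_map_in_topspace [OF assms] by simp
  ultimately show "s = 1"
    using cone_map_in_cone_base_iff [OF assms] by (simp add: suspension_point_def)
next
  assume "s = 1"
  then have *: "cone_map X (s, x) \<in> cone_base X"
    using cone_map_in_cone_base_iff [OF assms] by simp
  have "cone_base X \<subseteq> topspace (topological_cone X)"
    by (auto simp: cone_base_eq_image cone_map_in_topspace)
  with * show "suspension_map X (s, x) = suspension_point X"
    unfolding suspension_map_def suspension_point_def by blast
qed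

text \<open>The second assumption says that \<open>U\<close> is saturated, so \<open>U\<close> is
  the full preimage of its image and the quotient map detects openness.\<close>

lemma openin_suspension_map_image:
  assumes "openin (prod_topology (top_of_set {0..1}) X) U"
    and "\<And>s x x'. \<lbrakk>(s, x) \<in> U; x' \<in> topspace X; s = 0 \<or> s = 1\<rbrakk> \<Longrightarrow> (s, x') \<in> U"
  shows "openin (suspension X) (suspension_map X ` U)"
proof -
  let ?Z = "prod_topology (top_of_set {0..1}) X"
  have U: "U \<subseteq> topspace ?Z" using assms(1) by (rule openin_subset)
  have eq: "{p \<in> topspace ?Z. suspension_map X p \<in> suspension_map X ` U} = U"
  proof
    show "{p \<in> topspace ?Z. suspension_map X p \<in> suspension_map X ` U} \<subseteq> U"
    proof clarify
      fix s x s' x'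
      assume p: "(s, x) \<in> topspace ?Z" "(s', x') \<in> U" "suspension_map X (s, x) = suspension_map X (s', x')"
      moreover have "(s', x') \<in> topspace ?Z" using p U by blast
      ultimately have "s = s' \<and> (x = x' \<or> s = 0 \<or> s = 1)"
        by (subst (asm) suspension_map_eq_iff) auto
      then show "(s, x) \<in> U" using p assms(2) [of s' x' x] by auto
    qed
    show "U \<subseteq> {p \<in> topspace ?Z. suspension_map X p \<in> suspension_map X ` U}"
      using U by blast
  qed
  have "suspension_map X ` U \<subseteq> topspace (suspension X)"
    using U quotient_imp_surjective_map [OF quotient_map_suspension [of X]] by blast
  then have "openin ?Z {p \<in> topspace ?Z. suspension_map X p \<in> suspension_map X ` U} \<longleftrightarrow>
      openin (suspension X) (suspension_map X ` U)"
    using quotient_map_suspension [of X] unfolding quotient_map_def by blast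
  then show ?thesis
    unfolding eq using assms(1) by (rule iffD1)
qed

text \<open>Points at different heights are separated by their heights, points at the same height by
  their coordinates in \<open>X\<close>. Both cases use images of saturated open boxes.\<close>

lemma Hausdorff_space_suspension:
  assumes "Hausdorff_space X"
  shows "Hausdorff_space (suspension X)"
  unfolding Hausdorff_space_def
proof (intro allI impI, elim conjE)
  let ?Z = "prod_topology (top_of_set {0..1::real}) X"
  fix a b assume ab: "a \<in> topspace (suspension X)" "b \<in> topspace (suspension X)" "a \<noteq> b"
  have surj: "\<exists>s x. c = suspension_map X (s, x) \<and> s \<in> {0..1} \<and> x \<in> topspace X"
    if "c \<in> topspace (suspension X)" for c
  proof -
    have "c \<in> suspension_map X ` topspace ?Z"
      using that quotient_imp_surjective_map [OF quotient_map_suspension [of X]] by simp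
    then obtain p where "p \<in> topspace ?Z" "c = suspension_map X p" by blast
    then show ?thesis by (intro exI [of _ "fst p"] exI [of _ "snd p"]) auto
  qed
  obtain s x t y where
    a: "a = suspension_map X (s, x)" "s \<in> {0..1}" "x \<in> topspace X" and
    b: "b = suspension_map X (t, y)" "t \<in> {0..1}" "y \<in> topspace X"
    using surj [OF ab(1)] surj [OF ab(2)] by blast
  have ne: "\<not> (s = t \<and> (x = y \<or> s = 0 \<or> s = 1))"
    using ab a b suspension_map_eq_iff by metis
  \<comment> \<open>The assumptions \<open>UM\<close> and \<open>VN\<close> make the boxes
    saturated: a box that meets an end has to contain all of \<open>X\<close> in its second
    coordinate. \<open>disj\<close> covers separation by height and separation in \<open>X\<close>
    at once.\<close>
  have sep: "\<exists>U V. openin (suspension X) U \<and> openin (suspension X) V \<and> a \<in> U \<and> b \<in> V \<and> disjnt U V"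
    if U: "open U" "s \<in> U" and V: "open V" "t \<in> V"
      and M: "openin X M" "x \<in> M" and N: "openin X N" "y \<in> N"
      and UM: "M = topspace X \<or> U \<inter> {0, 1} = {}" and VN: "N = topspace X \<or> V \<inter> {0, 1} = {}"
      and disj: "U \<inter> V = {} \<or> U \<inter> {0, 1} = {} \<and> M \<inter> N = {}" for U V M N
  proof (intro exI conjI)
    let ?U = "({0..1} \<inter> U) \<times> M" and ?V = "({0..1} \<inter> V) \<times> N"
    show "openin (suspension X) (suspension_map X ` ?U)"
      using U M UM by (intro openin_suspension_map_image) (auto simp: openin_prod_Times_iff openin_open_Int)
    show "openin (suspension X) (suspension_map X ` ?V)"
      using V N VN by (intro openin_suspension_map_image) (auto simp: openin_prod_Times_iff openin_open_Int)
    show "a \<in> suspension_map X ` ?U" "b \<in> suspension_map X ` ?V"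
      using a b U V M N by auto
    show "disjnt (suspension_map X ` ?U) (suspension_map X ` ?V)"
    proof -
      have False if "(u, p) \<in> ?U" "(v, q) \<in> ?V" "suspension_map X (u, p) = suspension_map X (v, q)" for u p v q
      proof -
        have uv: "u \<in> {0..1}" "p \<in> topspace X" "v \<in> {0..1}" "q \<in> topspace X"
          using that(1,2) openin_subset [OF M(1)] openin_subset [OF N(1)] by auto
        have "u = v \<and> (p = q \<or> u = 0 \<or> u = 1)"
          by (rule suspension_map_eq_iff [OF uv, THEN iffD1, OF that(3)])
        then show False using disj that by auto
      qed
      then show ?thesis unfolding disjnt_iff by force
    qed
  qed
  show "\<exists>U V. openin (suspension X) U \<and> openin (suspension X) V \<and> a \<in> U \<and> b \<in> V \<and> disjnt U V"
  proof (cases "s = t")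
    case False
    then obtain U V :: "real set" where "open U" "open V" "s \<in> U" "t \<in> V" "U \<inter> V = {}"
      using hausdorff by metis
    then show ?thesis
      using a b by (intro sep [of U V "topspace X" "topspace X"]) auto
  next
    case True
    \<comment> \<open>Distinct points of equal height lie strictly between the ends, so boxes over
      the open interval can be used.\<close>
    then have "x \<noteq> y" "s \<noteq> 0" "s \<noteq> 1" using ne by auto
    moreover obtain M N where "openin X M" "openin X N" "x \<in> M" "y \<in> N" "disjnt M N"
      using assms \<open>x \<noteq> y\<close> a b unfolding Hausdorff_space_def by metis
    ultimately show ?thesis
      using a b True by (intro sep [of "{0<..<1}" "{0<..<1}" M N]) (auto simp: disjnt_def)
  qed
qed

section \<open>Simplices, tuples and joins under permutations\<close>

lemma standard_simplex_pred_iff: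
  assumes "n \<ge> 1"
  shows "t \<in> standard_simplex (n - 1) \<longleftrightarrow>
           (\<forall>i. 0 \<le> t i \<and> t i \<le> 1) \<and> (\<forall>i\<ge>n. t i = 0) \<and> sum t {..<n} = 1"
proof -
  \<comment> \<open>\<open>standard_simplex p\<close> allows indices up to and including
    \<open>p\<close>; the truncated subtraction gives the right range because \<open>n\<close> is
    positive.\<close>
  have "{..n - 1} = {..<n}" "\<And>i. n - 1 < i \<longleftrightarrow> n \<le> i"
    using assms by auto
  then show ?thesis by (simp add: standard_simplex_def)
qed

lemma standard_simplex_permute:
  assumes "n \<ge> 1" "\<sigma> permutes {..<n}" "t \<in> standard_simplex (n - 1)"
  shows "t \<circ> \<sigma> \<in> standard_simplex (n - 1)"
  using assms(3) permutes_not_in [OF assms(2)] sum.permute [OF assms(2), of t]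
  unfolding standard_simplex_pred_iff [OF assms(1)] by simp

lemma PiE_permute:
  assumes "\<sigma> permutes I" "f \<in> I \<rightarrow>\<^sub>E A"
  shows "f \<circ> \<sigma> \<in> I \<rightarrow>\<^sub>E A"
  using assms permutes_in_image [OF assms(1)] permutes_not_in [OF assms(1)]
  by (auto simp: PiE_iff extensional_def)

text \<open>This relation, and likewise \<open>symmetric_join_rel\<close> below, repeats the one
  inside the definition of the join in the same form, so that unfolding identifies them.\<close>

definition join_rel ::
    "nat \<Rightarrow> 'a topology \<Rightarrow> (((nat \<Rightarrow> 'a) \<times> (nat \<Rightarrow> real)) \<times> ((nat \<Rightarrow> 'a) \<times> (nat \<Rightarrow> real))) set" where
  "join_rel n X =
       {((x, t), (x', t')). (x, t) \<in> topspace (pre_join n X) \<and> (x', t') \<in> topspace (pre_join n X) \<and>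
          t = t' \<and> (\<forall>j<n. t j \<noteq> 0 \<longrightarrow> x j = x' j)}"

definition join_permute :: "(nat \<Rightarrow> nat) \<Rightarrow> (nat \<Rightarrow> 'a) \<times> (nat \<Rightarrow> real) \<Rightarrow> (nat \<Rightarrow> 'a) \<times> (nat \<Rightarrow> real)" where
  "join_permute \<sigma> = (\<lambda>(x, t). (x \<circ> \<sigma>, t \<circ> \<sigma>))"

definition symmetric_join_rel ::
    "nat \<Rightarrow> 'a topology \<Rightarrow> (((nat \<Rightarrow> 'a) \<times> (nat \<Rightarrow> real)) set \<times> ((nat \<Rightarrow> 'a) \<times> (nat \<Rightarrow> real)) set) set" where
  "symmetric_join_rel n X =
       {(c, d). c \<in> topspace (iterated_join n X) \<and> d \<in> topspace (iterated_join n X) \<and>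
          (\<exists>\<sigma>. \<sigma> permutes {..<n} \<and> d = join_permute \<sigma> ` c)}"

lemma topspace_pre_join [simp]:
  "topspace (pre_join n X) = ({..<n} \<rightarrow>\<^sub>E topspace X) \<times> standard_simplex (n - 1)"
  by (simp add: pre_join_def)

lemma join_rel_iff:
  "((x, t), (x', t')) \<in> join_rel n X \<longleftrightarrow>
     (x, t) \<in> topspace (pre_join n X) \<and> (x', t') \<in> topspace (pre_join n X) \<and>
     t = t' \<and> (\<forall>j<n. t j \<noteq> 0 \<longrightarrow> x j = x' j)"
  by (simp only: join_rel_def mem_Collect_eq prod.case)

lemma join_permute_pair: "join_permute \<sigma> (x, t) = (x \<circ> \<sigma>, t \<circ> \<sigma>)"
  by (simp add: join_permute_def)

lemma equiv_join_rel: "equiv (topspace (pre_join n X)) (join_rel n X)"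
proof (intro equivI refl_onI symI transI)
  show "join_rel n X \<subseteq> topspace (pre_join n X) \<times> topspace (pre_join n X)"
    by (auto simp only: join_rel_iff)
qed (simp_all add: split_paired_all join_rel_iff del: topspace_pre_join)

lemma join_permute_in_topspace:
  assumes "n \<ge> 1" "\<sigma> permutes {..<n}" "p \<in> topspace (pre_join n X)"
  shows "join_permute \<sigma> p \<in> topspace (pre_join n X)"
proof -
  obtain x t where p: "p = (x, t)" by (rule prod.exhaust)
  then show ?thesis
    using assms(3) PiE_permute [OF assms(2), of x] standard_simplex_permute [OF assms(1,2), of t]
    by (simp add: join_permute_pair)
qed

lemma join_rel_permute:
  assumes "n \<ge> 1" "\<sigma> permutes {..<n}" "(p, p') \<in> join_rel n X"
  shows "(join_permute \<sigma> p, join_permute \<sigma> p') \<in> join_rel n X"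
proof -
  obtain x t x' t' where p: "p = (x, t)" "p' = (x', t')" by (metis prod.exhaust)
  have "\<sigma> j < n" if "j < n" for j
    using permutes_in_image [OF assms(2), of j] that by simp
  then show ?thesis
    using assms(3) join_permute_in_topspace [OF assms(1,2), of p X]
      join_permute_in_topspace [OF assms(1,2), of p' X]
    by (auto simp: p join_rel_iff join_permute_pair simp del: topspace_pre_join)
qed

lemma join_permute_compose: "join_permute \<tau> (join_permute \<sigma> p) = join_permute (\<sigma> \<circ> \<tau>) p"
  by (cases p) (simp add: join_permute_pair o_assoc)

lemma join_permute_id: "join_permute id p = p"
  by (cases p) (simp add: join_permute_pair)

lemma join_permute_inv:
  assumes "\<sigma> permutes {..<n}"
  shows "join_permute (inv_into UNIV \<sigma>) (join_permute \<sigma> p) = p" "join_permute \<sigma> (join_permute (inv_into UNIV \<sigma>) p) = p"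
  unfolding join_permute_compose permutes_inv_o [OF assms] by (rule join_permute_id)+

text \<open>The permutation action on the join is defined by images of classes. This computes it on
  representatives; the inverse permutation supplies the preimages needed for equality.\<close>

lemma join_permute_image_class:
  assumes n: "n \<ge> 1" and \<sigma>: "\<sigma> permutes {..<n}" and p: "p \<in> topspace (pre_join n X)"
  shows "join_permute \<sigma> ` (join_rel n X `` {p}) = join_rel n X `` {join_permute \<sigma> p}"
proof (intro subset_antisym subsetI)
  fix q assume "q \<in> join_permute \<sigma> ` (join_rel n X `` {p})"
  then obtain p' where p': "(p, p') \<in> join_rel n X" "q = join_permute \<sigma> p'"
    by blast
  then show "q \<in> join_rel n X `` {join_permute \<sigma> p}"
    using join_rel_permute [OF n \<sigma> p'(1)] by (simp only: Image_singleton_iff)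
next
  fix q assume "q \<in> join_rel n X `` {join_permute \<sigma> p}"
  then have "(join_permute \<sigma> p, q) \<in> join_rel n X" by (simp only: Image_singleton_iff)
  then have "(p, join_permute (inv_into UNIV \<sigma>) q) \<in> join_rel n X"
    using join_rel_permute [OF n permutes_inv [OF \<sigma>]] join_permute_inv(1) [OF \<sigma>] by metis
  then have "join_permute (inv_into UNIV \<sigma>) q \<in> join_rel n X `` {p}" by (simp only: Image_singleton_iff)
  then show "q \<in> join_permute \<sigma> ` (join_rel n X `` {p})"
    using join_permute_inv(2) [OF \<sigma>] by (metis imageI)
qed

lemma equiv_symmetric_join_rel: "equiv (topspace (iterated_join n X)) (symmetric_join_rel n X)"
proof (intro equivI refl_onI symI transI)
  show "symmetric_join_rel n X \<subseteq> topspace (iterated_join n X) \<times> topspace (iterated_join n X)"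
    unfolding symmetric_join_rel_def by blast
  fix c assume c: "c \<in> topspace (iterated_join n X)"
  have "id permutes {..<n}" "c = join_permute id ` c"
    by (simp_all add: permutes_id join_permute_id)
  with c show "(c, c) \<in> symmetric_join_rel n X" unfolding symmetric_join_rel_def by blast
next
  fix c d assume cd: "(c, d) \<in> symmetric_join_rel n X"
  then obtain \<sigma> where \<sigma>: "\<sigma> permutes {..<n}" "d = join_permute \<sigma> ` c"
    unfolding symmetric_join_rel_def by blast
  then have "c = join_permute (inv_into UNIV \<sigma>) ` d"
    by (simp only: image_image join_permute_inv(1) [OF \<sigma>(1)] image_ident)
  with permutes_inv [OF \<sigma>(1)] cd show "(d, c) \<in> symmetric_join_rel n X"
    unfolding symmetric_join_rel_def by blast
next
  fix c d e assume cde: "(c, d) \<in> symmetric_join_rel n X" "(d, e) \<in> symmetric_join_rel n X"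
  then obtain \<sigma> \<tau> where \<sigma>: "\<sigma> permutes {..<n}" "d = join_permute \<sigma> ` c"
    and \<tau>: "\<tau> permutes {..<n}" "e = join_permute \<tau> ` d"
    unfolding symmetric_join_rel_def by blast
  then have "e = join_permute (\<sigma> \<circ> \<tau>) ` c"
    by (simp only: image_image join_permute_compose)
  with permutes_compose [OF \<tau>(1) \<sigma>(1)] cde show "(c, e) \<in> symmetric_join_rel n X"
    unfolding symmetric_join_rel_def by blast
qed

definition join_map ::
    "nat \<Rightarrow> 'a topology \<Rightarrow> (nat \<Rightarrow> 'a) \<times> (nat \<Rightarrow> real) \<Rightarrow> ((nat \<Rightarrow> 'a) \<times> (nat \<Rightarrow> real)) set set" where
  "join_map n X p = symmetric_join_rel n X `` {join_rel n X `` {p}}"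

lemma quotient_map_join: "quotient_map (pre_join n X) (symmetric_join n X) (join_map n X)"
proof -
  have "quotient_map (pre_join n X) (iterated_join n X) (\<lambda>p. join_rel n X `` {p})"
    unfolding iterated_join_def join_rel_def by (rule quotient_map_quotient_topology)
  moreover have "quotient_map (iterated_join n X) (symmetric_join n X) (\<lambda>c. symmetric_join_rel n X `` {c})"
    unfolding symmetric_join_def symmetric_join_rel_def join_permute_def by (rule quotient_map_quotient_topology)
  ultimately have "quotient_map (pre_join n X) (symmetric_join n X)
      ((\<lambda>c. symmetric_join_rel n X `` {c}) \<circ> (\<lambda>p. join_rel n X `` {p}))"
    by (rule quotient_map_compose)
  then show ?thesis
    by (simp add: o_def join_map_def [abs_def])
qed

text \<open>A permutation can be applied to representatives before the coordinates of weight zero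
  are forgotten, so the two successive quotients merge into one condition.\<close>

lemma join_map_eq_iff:
  assumes n: "n \<ge> 1" and p: "(x, t) \<in> topspace (pre_join n X)" "(x', t') \<in> topspace (pre_join n X)"
  shows "join_map n X (x, t) = join_map n X (x', t') \<longleftrightarrow>
    (\<exists>\<sigma>. \<sigma> permutes {..<n} \<and> t' = t \<circ> \<sigma> \<and> (\<forall>j<n. t' j \<noteq> 0 \<longrightarrow> x' j = x (\<sigma> j)))"
proof -
  have cls: "join_rel n X `` {p} \<in> topspace (iterated_join n X)" if "p \<in> topspace (pre_join n X)" for p
    unfolding iterated_join_def join_rel_def [symmetric] topspace_quotient_topology using that by (rule quotientI)
  \<comment> \<open>For a fixed permutation, equality of classes is \<open>join_rel\<close> between
    \<open>(x', t')\<close> and the permuted representative.\<close>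
  have step: "join_rel n X `` {(x', t')} = join_permute \<sigma> ` (join_rel n X `` {(x, t)}) \<longleftrightarrow>
      t' = t \<circ> \<sigma> \<and> (\<forall>j<n. t' j \<noteq> 0 \<longrightarrow> x' j = x (\<sigma> j))"
    if \<sigma>: "\<sigma> permutes {..<n}" for \<sigma>
  proof -
    note p\<sigma> = join_permute_in_topspace [OF n \<sigma> p(1)]
    have "join_rel n X `` {(x', t')} = join_permute \<sigma> ` (join_rel n X `` {(x, t)}) \<longleftrightarrow>
        ((x', t'), join_permute \<sigma> (x, t)) \<in> join_rel n X"
      unfolding join_permute_image_class [OF n \<sigma> p(1)]
      by (rule eq_equiv_class_iff [OF equiv_join_rel p(2) p\<sigma>])
    then show ?thesis
      using p(2) p\<sigma> by (simp add: join_rel_iff join_permute_pair del: topspace_pre_join)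
  qed
  have "join_map n X (x, t) = join_map n X (x', t') \<longleftrightarrow>
      (join_rel n X `` {(x, t)}, join_rel n X `` {(x', t')}) \<in> symmetric_join_rel n X"
    unfolding join_map_def by (rule eq_equiv_class_iff [OF equiv_symmetric_join_rel cls cls]) fact+
  also have "\<dots> \<longleftrightarrow> (\<exists>\<sigma>. \<sigma> permutes {..<n} \<and>
      join_rel n X `` {(x', t')} = join_permute \<sigma> ` (join_rel n X `` {(x, t)}))"
    using cls [OF p(1)] cls [OF p(2)] unfolding symmetric_join_rel_def by blast
  also have "\<dots> \<longleftrightarrow> (\<exists>\<sigma>. \<sigma> permutes {..<n} \<and> t' = t \<circ> \<sigma> \<and>
      (\<forall>j<n. t' j \<noteq> 0 \<longrightarrow> x' j = x (\<sigma> j)))"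
    by (intro ex_cong1 conj_cong refl step)
  finally show ?thesis .
qed

section \<open>Projection onto the reduced symmetric product\<close>

lemma equiv_perm_rel: "equiv (topspace (power_topology n Y)) (perm_rel n Y)"
proof (intro equivI refl_onI symI transI)
  show "perm_rel n Y \<subseteq> topspace (power_topology n Y) \<times> topspace (power_topology n Y)"
    unfolding perm_rel_def by blast
  fix f assume f: "f \<in> topspace (power_topology n Y)"
  then show "(f, f) \<in> perm_rel n Y"
    unfolding perm_rel_def using permutes_id [of "{..<n}"] by fastforce
next
  fix f g assume fg: "(f, g) \<in> perm_rel n Y"
  then obtain \<sigma> where \<sigma>: "\<sigma> permutes {..<n}" "g = f \<circ> \<sigma>" unfolding perm_rel_def by blast
  then have "f = g \<circ> inv_into UNIV \<sigma>"
    by (simp add: o_assoc [symmetric] permutes_inv_o)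
  with permutes_inv [OF \<sigma>(1)] fg show "(g, f) \<in> perm_rel n Y" unfolding perm_rel_def by blast
next
  fix f g h assume fgh: "(f, g) \<in> perm_rel n Y" "(g, h) \<in> perm_rel n Y"
  then obtain \<sigma> \<tau> where \<sigma>: "\<sigma> permutes {..<n}" "g = f \<circ> \<sigma>"
    and \<tau>: "\<tau> permutes {..<n}" "h = g \<circ> \<tau>" unfolding perm_rel_def by blast
  then have "h = f \<circ> (\<sigma> \<circ> \<tau>)" by (simp add: o_assoc)
  with permutes_compose [OF \<tau>(1) \<sigma>(1)] fgh show "(f, h) \<in> perm_rel n Y" unfolding perm_rel_def by blast
qed

lemma perm_class_eq_iff:
  assumes "f \<in> topspace (power_topology n Y)" "g \<in> topspace (power_topology n Y)"
  shows "perm_rel n Y `` {f} = perm_rel n Y `` {g} \<longleftrightarrow> (\<exists>\<sigma>. \<sigma> permutes {..<n} \<and> g = f \<circ> \<sigma>)"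
  using eq_equiv_class_iff [OF equiv_perm_rel assms] assms unfolding perm_rel_def by blast

lemma fun_upd_in_power_topology:
  assumes "g \<in> topspace (power_topology m Y)" "y \<in> topspace Y"
  shows "g(m := y) \<in> topspace (power_topology (Suc m) Y)"
  using assms by (auto simp: PiE_iff extensional_def)

text \<open>A permutation of \<open>{..<m}\<close> fixes \<open>m\<close>, so it commutes with
  setting the entry at \<open>m\<close>. All members of the union in \<open>adjoin_basepoint\<close>
  are therefore the same class.\<close>

lemma adjoin_basepoint_class:
  assumes g: "g \<in> topspace (power_topology m Y)" and y: "y \<in> topspace Y"
  shows "adjoin_basepoint m Y y (perm_rel m Y `` {g}) = perm_rel (Suc m) Y `` {g(m := y)}"
proof -
  have "perm_rel (Suc m) Y `` {f(m := y)} = perm_rel (Suc m) Y `` {g(m := y)}"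
    if f: "f \<in> perm_rel m Y `` {g}" for f
  proof -
    obtain \<sigma> where \<sigma>: "\<sigma> permutes {..<m}" "f = g \<circ> \<sigma>" "f \<in> topspace (power_topology m Y)"
      using f unfolding perm_rel_def by blast
    have "\<sigma> permutes {..<Suc m}"
      using \<sigma>(1) by (rule permutes_subset) auto
    moreover have "f(m := y) = g(m := y) \<circ> \<sigma>"
    proof
      fix i
      have m: "\<sigma> m = m" using permutes_not_in [OF \<sigma>(1), of m] by simp
      then have "\<sigma> i = m \<longleftrightarrow> i = m" using permutes_inj [OF \<sigma>(1)] by (metis injD)
      then show "(f(m := y)) i = (g(m := y) \<circ> \<sigma>) i" by (simp add: \<sigma>(2))
    qed
    ultimately show ?thesis
      using perm_class_eq_iff fun_upd_in_power_topology [OF _ y] g \<sigma>(3) by metis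
  qed
  moreover have "g \<in> perm_rel m Y `` {g}"
    using equiv_class_self [OF equiv_perm_rel g] .
  ultimately show ?thesis
    unfolding adjoin_basepoint_def by blast
qed

text \<open>The adjoined base point sits in the last place, but up to permutation its position is
  immaterial.\<close>

lemma perm_class_in_adjoin_basepoint_iff:
  assumes n: "n \<ge> 1" and f: "f \<in> topspace (power_topology n Y)" and y: "y \<in> topspace Y"
  shows "perm_rel n Y `` {f} \<in> adjoin_basepoint (n - 1) Y y ` topspace (symmetric_product (n - 1) Y)
           \<longleftrightarrow> (\<exists>i<n. f i = y)"
proof -
  obtain m where m: "n = Suc m" using n by (cases n) auto
  have "topspace (symmetric_product m Y) = (\<lambda>g. perm_rel m Y `` {g}) ` topspace (power_topology m Y)"
    unfolding symmetric_product_def topspace_quotient_topology by (auto simp: quotient_def)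
  then have "perm_rel n Y `` {f} \<in> adjoin_basepoint (n - 1) Y y ` topspace (symmetric_product (n - 1) Y)
     \<longleftrightarrow> (\<exists>g\<in>topspace (power_topology m Y). perm_rel n Y `` {f} = perm_rel n Y `` {g(m := y)})"
    using adjoin_basepoint_class [OF _ y, of _ m] by (auto simp: m image_iff)
  also have "\<dots> \<longleftrightarrow> (\<exists>g\<in>topspace (power_topology m Y). \<exists>\<sigma>. \<sigma> permutes {..<n} \<and> g(m := y) = f \<circ> \<sigma>)"
    using perm_class_eq_iff [OF f] fun_upd_in_power_topology [OF _ y, of _ m] m by metis
  also have "\<dots> \<longleftrightarrow> (\<exists>i<n. f i = y)"
  proof safe
    fix g \<sigma> assume *: "\<sigma> permutes {..<n}" "g(m := y) = f \<circ> \<sigma>"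
    have "\<sigma> m < n" using permutes_in_image [OF *(1), of m] m by simp
    moreover have "f (\<sigma> m) = y" using fun_cong [OF *(2), of m] by simp
    ultimately show "\<exists>i<n. f i = y" by blast
  next
    fix i assume i: "i < n" "y = f i"
    \<comment> \<open>Moves the base point entry from place \<open>i\<close> to the last place
      \<open>m\<close>.\<close>
    define \<sigma> where "\<sigma> = Transposition.transpose i m"
    have \<sigma>: "\<sigma> permutes {..<n}" unfolding \<sigma>_def using i m by (intro permutes_swap_id) auto
    \<comment> \<open>Points of the \<open>m\<close>-th power are undefined outside
      \<open>{..<m}\<close>, so the last entry is erased rather than kept.\<close>
    define g where "g = (f \<circ> \<sigma>)(m := undefined)"
    have "f \<circ> \<sigma> \<in> {..<n} \<rightarrow>\<^sub>E topspace Y" using PiE_permute [OF \<sigma>] f by simp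
    then have "g \<in> topspace (power_topology m Y)"
      by (auto simp: g_def m PiE_iff extensional_def simp del: o_apply)
    moreover have "g(m := f i) = f \<circ> \<sigma>" by (auto simp: g_def \<sigma>_def)
    ultimately show "\<exists>g\<in>topspace (power_topology m Y). \<exists>\<sigma>. \<sigma> permutes {..<n} \<and> g(m := f i) = f \<circ> \<sigma>"
      using \<sigma> by blast
  qed
  finally show ?thesis .
qed

definition reduced_map :: "nat \<Rightarrow> 'b topology \<Rightarrow> 'b \<Rightarrow> (nat \<Rightarrow> 'b) \<Rightarrow> (nat \<Rightarrow> 'b) set set" where
  "reduced_map n Y y f =
     collapse_rel (symmetric_product n Y)
       (adjoin_basepoint (n - 1) Y y ` topspace (symmetric_product (n - 1) Y)) `` {perm_rel n Y `` {f}}"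

lemma quotient_map_reduced:
  "quotient_map (power_topology n Y) (reduced_symmetric_product n Y y) (reduced_map n Y y)"
proof -
  have "quotient_map (power_topology n Y) (symmetric_product n Y) (\<lambda>f. perm_rel n Y `` {f})"
    unfolding symmetric_product_def by (rule quotient_map_quotient_topology)
  from quotient_map_compose [OF this quotient_map_collapse] show ?thesis
    unfolding reduced_symmetric_product_def reduced_map_def o_def by blast
qed

lemma reduced_map_eq_iff:
  assumes n: "n \<ge> 1" and y: "y \<in> topspace Y"
    and f: "f \<in> topspace (power_topology n Y)" and g: "g \<in> topspace (power_topology n Y)"
  shows "reduced_map n Y y f = reduced_map n Y y g \<longleftrightarrow>
    (\<exists>\<sigma>. \<sigma> permutes {..<n} \<and> g = f \<circ> \<sigma>) \<or> (\<exists>i<n. f i = y) \<and> (\<exists>i<n. g i = y)"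
proof -
  have "perm_rel n Y `` {h} \<in> topspace (symmetric_product n Y)" if "h \<in> topspace (power_topology n Y)" for h
    unfolding symmetric_product_def topspace_quotient_topology using that by (rule quotientI)
  from collapse_class_eq_iff [OF this [OF f] this [OF g]] show ?thesis
    unfolding reduced_map_def
    by (simp only: perm_class_in_adjoin_basepoint_iff [OF n f y]
        perm_class_in_adjoin_basepoint_iff [OF n g y] perm_class_eq_iff [OF f g])
qed

section \<open>Polar coordinates on the cube\<close>

lemma continuous_map_Max:
  assumes "finite I" "I \<noteq> {}" "\<And>i. i \<in> I \<Longrightarrow> continuous_map X euclideanreal (\<lambda>x. f x i)"
  shows "continuous_map X euclideanreal (\<lambda>x. Max (f x ` I))"
  using assms
proof (induction I rule: finite_ne_induct)
  case (insert i I)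
  then show ?case
    by (simp add: continuous_map_real_max)
qed simp

text \<open>Polar coordinates for the sup norm: \<open>s\<close> is the radius and \<open>t\<close>
  the direction. The restriction to \<open>{..<n}\<close> makes the value a point of the product
  topology.\<close>

definition cube_polar :: "nat \<Rightarrow> real \<times> (nat \<Rightarrow> real) \<Rightarrow> nat \<Rightarrow> real" where
  "cube_polar n = (\<lambda>(s, t). \<lambda>i\<in>{..<n}. s * t i / Max (t ` {..<n}))"

context
  fixes n :: nat and t :: "nat \<Rightarrow> real"
  assumes n: "n \<ge> 1" and t: "t \<in> standard_simplex (n - 1)"
begin

lemma standard_simplex_Max_ge: "i < n \<Longrightarrow> t i \<le> Max (t ` {..<n})"
  by simp

lemma standard_simplex_Max_pos: "Max (t ` {..<n}) > 0"
proof -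
  have "\<exists>i<n. t i > 0"
  proof (rule ccontr)
    assume "\<not> (\<exists>i<n. t i > 0)"
    then have "sum t {..<n} \<le> 0" by (intro sum_nonpos) (metis lessThan_iff not_less)
    then show False using t by (simp only: standard_simplex_pred_iff [OF n])
  qed
  then show ?thesis using standard_simplex_Max_ge by (meson less_le_trans)
qed

lemma cube_polar_in_unit_interval:
  assumes "s \<in> {0..1}" "i < n"
  shows "cube_polar n (s, t) i \<in> {0..1}"
proof -
  have "0 \<le> t i" using t by (simp only: standard_simplex_pred_iff [OF n])
  then have "0 \<le> t i / Max (t ` {..<n})" "t i / Max (t ` {..<n}) \<le> 1"
    using standard_simplex_Max_ge [OF assms(2)] standard_simplex_Max_pos by auto
  then have "s * (t i / Max (t ` {..<n})) \<in> {0..1}"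
    using assms(1) unfolding atLeastAtMost_iff by (blast intro: mult_le_one mult_nonneg_nonneg)
  then show ?thesis using assms(2) by (simp add: cube_polar_def)
qed

lemma cube_polar_le:
  assumes "s \<ge> 0" "i < n"
  shows "cube_polar n (s, t) i \<le> s"
proof -
  have "t i / Max (t ` {..<n}) \<le> 1"
    using standard_simplex_Max_ge [OF assms(2)] standard_simplex_Max_pos by auto
  then have "s * (t i / Max (t ` {..<n})) \<le> s"
    using mult_left_mono [OF _ assms(1)] by fastforce
  then show ?thesis using assms(2) by (simp add: cube_polar_def)
qed

lemma cube_polar_attains: "\<exists>i<n. cube_polar n (s, t) i = s"
proof -
  have "Max (t ` {..<n}) \<in> t ` {..<n}"
    using n by (intro Max_in) (auto simp: lessThan_empty_iff)
  then obtain i where "i < n" "t i = Max (t ` {..<n})" by auto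
  then show ?thesis
    using standard_simplex_Max_pos by (intro exI [of _ i]) (simp add: cube_polar_def)
qed

lemma cube_polar_eq_0_iff: "i < n \<Longrightarrow> cube_polar n (s, t) i = 0 \<longleftrightarrow> s = 0 \<or> t i = 0"
  using standard_simplex_Max_pos by (simp add: cube_polar_def)

lemma cube_polar_eq_1_iff:
  assumes "s \<in> {0..1}"
  shows "(\<exists>i<n. cube_polar n (s, t) i = 1) \<longleftrightarrow> s = 1"
  using cube_polar_attains [of s] cube_polar_le [of s] assms by force

text \<open>The entries of \<open>t\<close> add up to 1, so the sum of the cube point together with
  a nonzero radius recovers the normalising maximum.\<close>

lemma sum_cube_polar: "(\<Sum>i<n. cube_polar n (s, t) i) = s / Max (t ` {..<n})"
proof -
  have "(\<Sum>i<n. cube_polar n (s, t) i) = s * sum t {..<n} / Max (t ` {..<n})"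
    by (simp add: cube_polar_def sum_distrib_left sum_divide_distrib)
  then show ?thesis using t by (simp only: standard_simplex_pred_iff [OF n])
qed

end

text \<open>Reindexing leaves the maximum unchanged.\<close>

lemma cube_polar_permute:
  assumes "\<sigma> permutes {..<n}" "i < n"
  shows "cube_polar n (s, t \<circ> \<sigma>) i = cube_polar n (s, t) (\<sigma> i)"
proof -
  have "(t \<circ> \<sigma>) ` {..<n} = t ` {..<n}"
    unfolding image_comp [symmetric] permutes_image [OF assms(1)] ..
  then show ?thesis
    using permutes_in_image [OF assms(1), of i] assms(2) by (simp add: cube_polar_def)
qed

text \<open>Both the largest entry and the sum are invariant under permutation. The first is the
  radius; for positive radius the second gives equal maxima, after which the entries of
  \<open>t'\<close> can be solved for. At radius 0 the direction is lost.\<close>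

lemma cube_polar_eq_permute_imp:
  assumes n: "n \<ge> 1" and t: "t \<in> standard_simplex (n - 1)" and t': "t' \<in> standard_simplex (n - 1)"
    and s: "s \<ge> 0" "s' \<ge> 0" and \<sigma>: "\<sigma> permutes {..<n}"
    and eq: "\<And>i. i < n \<Longrightarrow> cube_polar n (s', t') i = cube_polar n (s, t) (\<sigma> i)"
  shows "s' = s" and "s > 0 \<Longrightarrow> t' = t \<circ> \<sigma>"
proof -
  note M = standard_simplex_Max_pos [OF n t] standard_simplex_Max_pos [OF n t']
  have \<sigma>n: "\<sigma> i < n \<longleftrightarrow> i < n" for i using permutes_in_image [OF \<sigma>, of i] by simp
  obtain i where i: "i < n" "cube_polar n (s', t') i = s'"
    using cube_polar_attains [OF n t'] by blast
  then have "s' \<le> s"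
    using cube_polar_le [OF n t s(1), of "\<sigma> i"] eq [OF i(1)] \<sigma>n by simp
  obtain j where j: "j < n" "cube_polar n (s, t) j = s"
    using cube_polar_attains [OF n t] by blast
  obtain k where "\<sigma> k = j" using permutes_surj [OF \<sigma>] by (metis surjD)
  then have "s \<le> s'"
    using cube_polar_le [OF n t' s(2), of k] eq [of k] \<sigma>n [of k] j by simp
  with \<open>s' \<le> s\<close> show ss: "s' = s" by simp
  assume "s > 0"
  have "(\<Sum>i<n. cube_polar n (s', t') i) = (\<Sum>i<n. cube_polar n (s, t) (\<sigma> i))"
    using eq by simp
  also have "\<dots> = (\<Sum>i<n. cube_polar n (s, t) i)"
    using sum.permute [OF \<sigma>, of "cube_polar n (s, t)"] by simp
  finally have "Max (t' ` {..<n}) = Max (t ` {..<n})"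
    unfolding sum_cube_polar [OF n t] sum_cube_polar [OF n t'] ss
    using \<open>s > 0\<close> M by (simp add: field_simps)
  then have "t' i = t (\<sigma> i)" if "i < n" for i
    using eq [OF that] that \<sigma>n [of i] M \<open>s > 0\<close> ss by (simp add: cube_polar_def)
  \<comment> \<open>Outside the index range the permutation is the identity and both simplex points
    vanish.\<close>
  moreover have "t' i = t (\<sigma> i)" if "i \<ge> n" for i
    using that t t' permutes_not_in [OF \<sigma>, of i] by (simp only: standard_simplex_pred_iff [OF n]) simp
  ultimately show "t' = t \<circ> \<sigma>"
    by (metis comp_apply ext not_le)
qed

abbreviation polar_topology :: "nat \<Rightarrow> (real \<times> (nat \<Rightarrow> real)) topology" where
  "polar_topology n \<equiv> prod_topology (top_of_set {0..1})
     (subtopology (powertop_real UNIV) (standard_simplex (n - 1)))"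

lemma continuous_map_fst_apply:
  "continuous_map Z (prod_topology X Y) f \<Longrightarrow> continuous_map Z X (\<lambda>z. fst (f z))"
  using continuous_map_compose [OF _ continuous_map_fst] by (fastforce simp: o_def)

lemma continuous_map_snd_apply:
  "continuous_map Z (prod_topology X Y) f \<Longrightarrow> continuous_map Z Y (\<lambda>z. snd (f z))"
  using continuous_map_compose [OF _ continuous_map_snd] by (fastforce simp: o_def)

lemma continuous_map_component_apply:
  "continuous_map Z (product_topology X I) f \<Longrightarrow> i \<in> I \<Longrightarrow> continuous_map Z (X i) (\<lambda>z. f z i)"
  by (simp add: continuous_map_componentwise)

text \<open>A continuous surjection from a compact space onto a Hausdorff space is a quotient map.
  For surjectivity, the radius is the largest entry and the direction is the cube point divided by
  its sum.\<close>

lemma quotient_map_cube_polar: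
  assumes n: "n \<ge> 1"
  shows "quotient_map (polar_topology n) (product_topology (\<lambda>_. top_of_set {0..1}) {..<n}) (cube_polar n)"
    (is "quotient_map ?P ?C _")
proof (rule continuous_imp_quotient_map)
  let ?\<Delta> = "subtopology (powertop_real UNIV) (standard_simplex (n - 1))"
  have s: "continuous_map ?P euclideanreal fst"
    using continuous_map_fst [of "top_of_set {0..1::real}" ?\<Delta>] by (simp add: continuous_map_in_subtopology)
  have t: "continuous_map ?P euclideanreal (\<lambda>p. snd p i)" for i
  proof -
    have "continuous_map ?P (powertop_real UNIV) snd"
      using continuous_map_snd [of "top_of_set {0..1::real}" ?\<Delta>]
      by (simp add: continuous_map_in_subtopology)
    from continuous_map_component_apply [OF this UNIV_I] show ?thesis .
  qed
  have "continuous_map ?P euclideanreal (\<lambda>p. fst p * snd p i / Max (snd p ` {..<n}))" for i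
    using n standard_simplex_Max_pos [OF n]
    by (intro continuous_map_real_divide continuous_map_real_mult s t continuous_map_Max) force+
  then have "continuous_map ?P (top_of_set {0..1}) (\<lambda>p. cube_polar n p i)" if "i < n" for i
    using that cube_polar_in_unit_interval [OF n _ _ that]
    unfolding continuous_map_in_subtopology
    by (auto simp: cube_polar_def case_prod_unfold)
  then show "continuous_map ?P ?C (cube_polar n)"
    unfolding continuous_map_componentwise by (auto simp: cube_polar_def)
  then have sub: "cube_polar n ` topspace ?P \<subseteq> topspace ?C"
    by (rule continuous_map_image_subset_topspace)
  show "compact_space ?P"
    using compactin_standard_simplex by (simp add: compact_space_prod_topology compact_space_subtopology)
  show "Hausdorff_space ?C"
    by (simp add: Hausdorff_space_product_topology Hausdorff_space_subtopology)
  show "cube_polar n ` topspace ?P = topspace ?C"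
  proof (intro subset_antisym sub subsetI)
    fix u assume "u \<in> topspace ?C"
    then have u: "\<And>i. i < n \<Longrightarrow> 0 \<le> u i \<and> u i \<le> 1" "u \<in> extensional {..<n}"
      by (auto simp: PiE_iff)
    define s where "s = Max (u ` {..<n})"
    have ne: "u ` {..<n} \<noteq> {}" using n by (auto simp: lessThan_empty_iff)
    then have "s \<in> u ` {..<n}" unfolding s_def by (intro Max_in) auto
    then obtain m where m: "m < n" "u m = s" by auto
    have us: "u i \<le> s" if "i < n" for i unfolding s_def using that by simp
    have s01: "s \<in> {0..1}" using m u by auto
    show "u \<in> cube_polar n ` topspace ?P"
    proof (cases "s = 0")
      case True
      \<comment> \<open>At the origin of the cube every direction will do.\<close>
      obtain t where t: "t \<in> standard_simplex (n - 1)" using nonempty_standard_simplex by blast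
      have "u i = 0" if "i < n" for i using us [OF that] u(1) [OF that] True by simp
      then have "u = cube_polar n (0, t)"
        using u(2) by (intro extensionalityI [of _ "{..<n}"]) (auto simp: cube_polar_def)
      then show ?thesis using t by auto
    next
      case False
      then have "s > 0" using s01 by simp
      define T where "T = sum u {..<n}"
      have "s \<le> T" unfolding T_def using m u member_le_sum [of m "{..<n}" u] by auto
      then have "T > 0" using \<open>s > 0\<close> by simp
      \<comment> \<open>Central projection to the simplex, extended by 0 as
        \<open>standard_simplex\<close> requires.\<close>
      define t where "t i = (if i < n then u i / T else 0)" for i
      have uT: "u i \<le> T" if "i < n" for i
        unfolding T_def using that u member_le_sum [of i "{..<n}" u] by auto
      have t: "t \<in> standard_simplex (n - 1)"
        unfolding standard_simplex_pred_iff [OF n]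
      proof (intro conjI allI impI)
        have "sum t {..<n} = (\<Sum>i<n. u i / T)" by (simp add: t_def)
        also have "\<dots> = 1" using \<open>T > 0\<close> by (simp add: T_def flip: sum_divide_distrib)
        finally show "sum t {..<n} = 1" .
      qed (use \<open>T > 0\<close> u uT in \<open>auto simp: t_def\<close>)
      have "Max (t ` {..<n}) = s / T"
        using m us \<open>T > 0\<close> by (intro Max_eqI) (auto simp: t_def divide_right_mono image_iff intro!: bexI [of _ m])
      then have "cube_polar n (s, t) i = u i" if "i < n" for i
        using that \<open>T > 0\<close> \<open>s > 0\<close> by (simp add: cube_polar_def t_def)
      then have "cube_polar n (s, t) = u"
        using u(2) by (intro extensionalityI [of _ "{..<n}"]) (auto simp: cube_polar_def)
      then show ?thesis using t s01 by force
    qed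
  qed
qed

section \<open>The homeomorphism\<close>

text \<open>Exchanges a pair of tuples for a tuple of pairs. The order within each pair is reversed
  to match the cylinder, where the height comes first.\<close>

lemma homeomorphic_map_prod_product:
  "homeomorphic_map (prod_topology (product_topology (\<lambda>_. X) I) (product_topology (\<lambda>_. Y) I))
     (product_topology (\<lambda>_. prod_topology Y X) I) (\<lambda>(x, u). \<lambda>i\<in>I. (u i, x i))"
  (is "homeomorphic_map ?S ?T ?f")
proof -
  let ?g = "\<lambda>f. (\<lambda>i\<in>I. snd (f i), \<lambda>i\<in>I. fst (f i))"
  have x: "continuous_map ?S X (\<lambda>p. fst p i)" and u: "continuous_map ?S Y (\<lambda>p. snd p i)" if "i \<in> I" for i
    using continuous_map_component_apply [OF continuous_map_fst that]
      continuous_map_component_apply [OF continuous_map_snd that] .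
  have "continuous_map ?S ?T ?f"
    unfolding continuous_map_componentwise
    using x u by (auto simp: case_prod_unfold continuous_map_paired)
  moreover have "continuous_map ?T ?S ?g"
    unfolding continuous_map_paired continuous_map_componentwise
    using continuous_map_fst_apply [OF continuous_map_product_projection [of _ I "\<lambda>_. prod_topology Y X"]]
      continuous_map_snd_apply [OF continuous_map_product_projection [of _ I "\<lambda>_. prod_topology Y X"]]
    by auto
  moreover have "?g (?f p) = p" if p: "p \<in> topspace ?S" for p
    using p by (auto simp: case_prod_unfold PiE_iff extensional_def fun_eq_iff)
  moreover have "?f (?g f) = f" if f: "f \<in> topspace ?T" for f
    using f by (auto simp: PiE_iff extensional_def fun_eq_iff)
  ultimately have "homeomorphic_maps ?S ?T ?f ?g"
    unfolding homeomorphic_maps_def by blast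
  then show ?thesis by (auto simp: homeomorphic_map_maps)
qed

theorem theorem1p3:
  fixes X :: "'a topology" and n :: nat
  assumes "connected_space X"
    and "locally_compact_space X"
    and "Hausdorff_space X"
    and "n \<ge> 1"
  shows "suspension (symmetric_join n X)
           homeomorphic_space
         reduced_symmetric_product n (suspension X) (suspension_point X)"
proof -
  note n = \<open>n \<ge> 1\<close>
  let ?I = "top_of_set {0..1::real}"
  let ?XX = "product_topology (\<lambda>_. X) {..<n}"
  let ?\<Delta> = "subtopology (powertop_real UNIV) (standard_simplex (n - 1))"
  let ?P = "prod_topology ?XX (polar_topology n)"
  let ?Z = "prod_topology ?I X"
  have XX: "locally_compact_space ?XX" "Hausdorff_space ?XX"
    using assms by (auto simp: locally_compact_space_product_topology Hausdorff_space_product_topology)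
  have I: "locally_compact_space ?I" "Hausdorff_space ?I"
    by (auto intro!: compact_imp_locally_compact_space Hausdorff_space_subtopology simp: compact_space_subtopology)
  have Z: "locally_compact_space ?Z" "Hausdorff_space ?Z"
    using I assms by (auto simp: locally_compact_space_prod_topology Hausdorff_space_prod_topology)

  define F where "F = (\<lambda>(x, s, t). suspension_map (symmetric_join n X) (s, join_map n X (x, t)))"
  have F: "quotient_map ?P (suspension (symmetric_join n X)) F"
  proof -
    \<comment> \<open>Moves the height \<open>s\<close> to the front; the swap is then undone by the
      same formula.\<close>
    have "homeomorphic_maps ?P (prod_topology ?I (pre_join n X))
        (\<lambda>p. (fst (snd p), (fst p, snd (snd p)))) (\<lambda>p. (fst (snd p), (fst p, snd (snd p))))"
      unfolding homeomorphic_maps_def pre_join_def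
      by (auto intro!: continuous_map_pairedI continuous_map_fst continuous_map_snd
          continuous_map_fst_apply [OF continuous_map_snd] continuous_map_snd_apply [OF continuous_map_snd])
    then have "quotient_map ?P (prod_topology ?I (pre_join n X)) (\<lambda>p. (fst (snd p), (fst p, snd (snd p))))"
      by (meson homeomorphic_map_maps homeomorphic_map_def)
    \<comment> \<open>The interval is compact Hausdorff, so the product of its identity with the
      quotient map onto the join is again a quotient map.\<close>
    moreover have "quotient_map (prod_topology ?I (pre_join n X)) (prod_topology ?I (symmetric_join n X))
        (\<lambda>(s, p). (s, join_map n X p))"
      using I quotient_map_join by (intro quotient_map_prod_right) auto
    ultimately have "quotient_map ?P (suspension (symmetric_join n X))
       (suspension_map (symmetric_join n X) \<circ> ((\<lambda>(s, p). (s, join_map n X p)) \<circ>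
          (\<lambda>p. (fst (snd p), (fst p, snd (snd p))))))"
      by (rule quotient_map_compose [OF quotient_map_compose quotient_map_suspension])
    moreover have "suspension_map (symmetric_join n X) \<circ> ((\<lambda>(s, p). (s, join_map n X p)) \<circ>
          (\<lambda>p. (fst (snd p), (fst p, snd (snd p))))) = F"
      by (auto simp: F_def)
    ultimately show ?thesis by simp
  qed

  define lift where "lift = (\<lambda>(x, p). \<lambda>i\<in>{..<n}. suspension_map X (cube_polar n p i, x i))"
  define G where "G = reduced_map n (suspension X) (suspension_point X) \<circ> lift"
  have lift: "quotient_map ?P (power_topology n (suspension X)) lift"
  proof -
    \<comment> \<open>Here local compactness of the power of \<open>X\<close> is what lets polar
      coordinates be applied beside it.\<close>
    have "quotient_map ?P (prod_topology ?XX (product_topology (\<lambda>_. ?I) {..<n}))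
       (\<lambda>(x, p). (x, cube_polar n p))"
      using XX quotient_map_cube_polar [OF n] by (intro quotient_map_prod_right) auto
    moreover have "quotient_map (product_topology (\<lambda>_. ?Z) {..<n}) (power_topology n (suspension X))
        (\<lambda>f. \<lambda>i\<in>{..<n}. suspension_map X (f i))"
      using quotient_map_power_topology [OF quotient_map_suspension Z] Hausdorff_space_suspension assms
      by blast
    ultimately have "quotient_map ?P (power_topology n (suspension X))
       ((\<lambda>f. \<lambda>i\<in>{..<n}. suspension_map X (f i)) \<circ> ((\<lambda>(x, u). \<lambda>i\<in>{..<n}. (u i, x i)) \<circ>
         (\<lambda>(x, p). (x, cube_polar n p))))"
      using homeomorphic_map_prod_product [unfolded homeomorphic_map_def, THEN conjunct1]
      by (intro quotient_map_compose)
    moreover have "(\<lambda>f. \<lambda>i\<in>{..<n}. suspension_map X (f i)) \<circ> ((\<lambda>(x, u). \<lambda>i\<in>{..<n}. (u i, x i)) \<circ>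
         (\<lambda>(x, p). (x, cube_polar n p))) = lift"
      by (auto simp: lift_def fun_eq_iff restrict_def)
    ultimately show ?thesis by simp
  qed
  then have G: "quotient_map ?P (reduced_symmetric_product n (suspension X) (suspension_point X)) G"
    unfolding G_def by (rule quotient_map_compose [OF _ quotient_map_reduced])

  have "F p = F p' \<longleftrightarrow> G p = G p'" if pp': "p \<in> topspace ?P" "p' \<in> topspace ?P" for p p'
  proof -
    obtain x s t where p: "p = (x, s, t)" "x \<in> {..<n} \<rightarrow>\<^sub>E topspace X" "s \<in> {0..1}" "t \<in> standard_simplex (n - 1)"
      using pp' by auto
    obtain x' s' t' where p': "p' = (x', s', t')" "x' \<in> {..<n} \<rightarrow>\<^sub>E topspace X" "s' \<in> {0..1}" "t' \<in> standard_simplex (n - 1)"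
      using pp' by auto
    have x: "x i \<in> topspace X" "x' i \<in> topspace X" if "i < n" for i
      using p(2) p'(2) that by auto
    let ?u = "cube_polar n (s, t)" and ?u' = "cube_polar n (s', t')"
    have u: "?u i \<in> {0..1}" "?u' i \<in> {0..1}" if "i < n" for i
      using cube_polar_in_unit_interval [OF n] p p' that by auto
    have pre: "(x, t) \<in> topspace (pre_join n X)" "(x', t') \<in> topspace (pre_join n X)"
      using p p' by auto
    then have J: "join_map n X (x, t) \<in> topspace (symmetric_join n X)"
        "join_map n X (x', t') \<in> topspace (symmetric_join n X)"
      using quotient_imp_surjective_map [OF quotient_map_join [of n X]] by blast+
    have lt: "lift p \<in> topspace (power_topology n (suspension X))"
       "lift p' \<in> topspace (power_topology n (suspension X))"
      using quotient_imp_surjective_map [OF lift] pp' by blast+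
    \<comment> \<open>A point of \<open>?P\<close> has a coordinate at index 0, as \<open>n\<close>
      is positive; so \<open>X\<close> has a point and the base point really lies in the
      suspension.\<close>
    have "topspace X \<noteq> {}" using x [of 0] n by auto
    note pt = suspension_point_in_suspension [OF this]

    have Feq: "F p = F p' \<longleftrightarrow> s = s' \<and>
       ((\<exists>\<sigma>. \<sigma> permutes {..<n} \<and> t' = t \<circ> \<sigma> \<and> (\<forall>j<n. t' j \<noteq> 0 \<longrightarrow> x' j = x (\<sigma> j))) \<or> s = 0 \<or> s = 1)"
      by (simp only: F_def p p' prod.case suspension_map_eq_iff [OF p(3) J(1) p'(3) J(2)] join_map_eq_iff [OF n pre])
    have "lift p i = suspension_point X \<longleftrightarrow> ?u i = 1" "lift p' i = suspension_point X \<longleftrightarrow> ?u' i = 1"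
      if "i < n" for i
      using that suspension_map_eq_point_iff [OF u(1) x(1)] suspension_map_eq_point_iff [OF u(2) x(2)]
      by (simp_all add: lift_def p p')
    \<comment> \<open>The largest cube coordinate is the radius, so an entry at the base point
      occurs exactly at radius 1.\<close>
    then have base: "(\<exists>i<n. lift p i = suspension_point X) \<longleftrightarrow> s = 1"
        "(\<exists>i<n. lift p' i = suspension_point X) \<longleftrightarrow> s' = 1"
      unfolding cube_polar_eq_1_iff [OF n p(4,3), symmetric] cube_polar_eq_1_iff [OF n p'(4,3), symmetric]
      by blast+
    \<comment> \<open>An entry at height 0 or 1 forgets its point of \<open>X\<close>.\<close>
    have lift_perm: "lift p' = lift p \<circ> \<sigma> \<longleftrightarrow>
        (\<forall>i<n. ?u' i = ?u (\<sigma> i) \<and> (x' i = x (\<sigma> i) \<or> ?u' i = 0 \<or> ?u' i = 1))"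
      if \<sigma>: "\<sigma> permutes {..<n}" for \<sigma>
    proof -
      have \<sigma>n: "\<sigma> i < n" if "i < n" for i using permutes_in_image [OF \<sigma>, of i] that by simp
      have "lift p' = lift p \<circ> \<sigma> \<longleftrightarrow> (\<forall>i<n. lift p' i = lift p (\<sigma> i))"
        using permutes_in_image [OF \<sigma>] by (auto simp: fun_eq_iff lift_def p p')
      also have "\<dots> \<longleftrightarrow> (\<forall>i<n. suspension_map X (?u' i, x' i) = suspension_map X (?u (\<sigma> i), x (\<sigma> i)))"
        using \<sigma>n by (simp add: lift_def p p')
      also have "\<dots> \<longleftrightarrow> (\<forall>i<n. ?u' i = ?u (\<sigma> i) \<and> (x' i = x (\<sigma> i) \<or> ?u' i = 0 \<or> ?u' i = 1))"
        using suspension_map_eq_iff [OF u(2) x(2) u(1) x(1)] \<sigma>n by simp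
      finally show ?thesis .
    qed
    have Geq: "G p = G p' \<longleftrightarrow> (\<exists>\<sigma>. \<sigma> permutes {..<n} \<and> lift p' = lift p \<circ> \<sigma>) \<or> s = 1 \<and> s' = 1"
      unfolding G_def o_apply reduced_map_eq_iff [OF n pt lt] base ..
    show ?thesis
    proof
      assume "F p = F p'"
      then consider \<sigma> where "s = s'" "\<sigma> permutes {..<n}" "t' = t \<circ> \<sigma>" "\<forall>j<n. t' j \<noteq> 0 \<longrightarrow> x' j = x (\<sigma> j)"
        | "s = 0" "s' = 0" | "s = 1" "s' = 1"
        unfolding Feq by blast
      then show "G p = G p'"
      proof cases
        case 1
        have "lift p' = lift p \<circ> \<sigma>"
          unfolding lift_perm [OF 1(2)]
        proof (intro allI impI conjI)
          fix i assume i: "i < n"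
          show "?u' i = ?u (\<sigma> i)"
            using cube_polar_permute [OF 1(2) i, of s' t] 1 by simp
          \<comment> \<open>Zero weight in the join becomes height 0 in the cube, so both sides
            forget the same coordinates.\<close>
          show "x' i = x (\<sigma> i) \<or> ?u' i = 0 \<or> ?u' i = 1"
            using 1(4) i cube_polar_eq_0_iff [OF n p'(4) i] by blast
        qed
        with 1 show ?thesis unfolding Geq by blast
      next
        case 2
        \<comment> \<open>At radius 0 every entry of both tuples is the cone point, whatever
          \<open>x\<close> and \<open>t\<close> are.\<close>
        have "lift p' = lift p \<circ> id"
          unfolding lift_perm [OF permutes_id] using 2 by (simp add: cube_polar_def)
        then show ?thesis unfolding Geq using permutes_id by blast
      next
        case 3
        then show ?thesis unfolding Geq by blast
      qed
    next
      assume "G p = G p'"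
      then consider \<sigma> where "\<sigma> permutes {..<n}" "lift p' = lift p \<circ> \<sigma>" | "s = 1" "s' = 1"
        unfolding Geq by blast
      then show "F p = F p'"
      proof cases
        case 1
        have eq: "?u' i = ?u (\<sigma> i)" "x' i = x (\<sigma> i) \<or> ?u' i = 0 \<or> ?u' i = 1" if "i < n" for i
          using 1 that lift_perm [OF 1(1)] by blast+
        have s0: "s \<ge> 0" "s' \<ge> 0" using p p' by auto
        have ss: "s' = s" and tt: "s > 0 \<Longrightarrow> t' = t \<circ> \<sigma>"
          using cube_polar_eq_permute_imp [OF n p(4) p'(4) s0 1(1) eq(1)] by blast+
        \<comment> \<open>Strictly between radius 0 and 1 no entry reaches height 1, and height 0
          means weight zero; at the remaining coordinates the points of \<open>X\<close> must agree.
          Radii 0 and 1 need no comparison, since there the whole join is collapsed.\<close>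
        have "x' i = x (\<sigma> i)" if "s \<noteq> 0" "s \<noteq> 1" "i < n" "t' i \<noteq> 0" for i
        proof -
          have "?u' i \<noteq> 0" using that cube_polar_eq_0_iff [OF n p'(4)] ss by simp
          moreover have "?u' i \<noteq> 1" using that cube_polar_eq_1_iff [OF n p'(4,3)] ss by blast
          ultimately show ?thesis using eq(2) that by blast
        qed
        then show ?thesis unfolding Feq using ss tt s0 1(1) by fastforce
      next
        case 2
        then show ?thesis unfolding Feq by blast
      qed
    qed
  qed
  with F G show ?thesis
    by (rule homeomorphic_space_if_quotient_maps_same_fibres)
qed

end
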